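(* Let $\gamma(s)$ be a pseudo null curve in $E_1^4$ with Frenet vector fields $F_1,F_2,F_3,F_4$. The tubular hypersurfaces that are formed as the envelope of a family of pseudo hyperspheres of constant radius $r$ whose centers lie on $\gamma(s)$ can be parametrized by $$T_1(s,t,w)=\gamma(s)\mp r\left(g\sin f\,F_2(s)+\cos f\,F_3(s)+\frac{\sin f}{2g}F_4(s)\right),$$ $$T_2(s,t,w)=\gamma(s)\mp r\left(g\cos f\,F_2(s)+\sin f\,F_3(s)+\frac{\cos f}{2g}F_4(s)\right),$$ $$T_3(s,t,w)=\gamma(s)\mp r\left(g\sinh f\,F_2(s)+\cosh f\,F_3(s)-\frac{\sinh f}{2g}F_4(s)\right).$$ Furthermore, the tubular hypersurfaces that are formed as the envelope of a family of pseudo hyperbolic hyperspheres of constant radius $r$ whose centers lie on $\gamma(s)$ can be parametrized by $$T_4(s,t,w)=\gamma(s)\mp r\left(g\cosh f\,F_2(s)+\sinh f\,F_3(s)-\frac{\cosh f}{2g}F_4(s)\right).$$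
   Context: $E_1^4$ is $\mathbb{R}^4$ with $\langle u,v\rangle=-u_1v_1+u_2v_2+u_3v_3+u_4v_4$. A pseudo null curve is a unit speed spacelike curve $\gamma(s)$ whose principal normal is null; it has a Frenet frame $F_1=\gamma',F_2,F_3,F_4$ with $\langle F_1,F_1\rangle=\langle F_3,F_3\rangle=\langle F_2,F_4\rangle=1$, all other products $\langle F_i,F_j\rangle$ zero, and $F_1'=k_1F_2$, $F_2'=k_2F_3$, $F_3'=k_3F_2-k_2F_4$, $F_4'=-k_1F_1-k_3F_3$, where $k_1=0$ if $\gamma$ is a straight line and $k_1=1$ otherwise. The pseudo hypersphere (resp. pseudo hyperbolic hypersphere) with center $p$ and radius $r>0$ is $\{u:\langle u-p,u-p\rangle=r^2\}$ (resp. $\{u:\langle u-p,u-p\rangle=-r^2\}$). With $\lambda=1$ for pseudo hyperspheres and $\lambda=-1$ for pseudo hyperbolic hyperspheres, a hypersurface $T(s,t,w)$ is (formed as) the envelope of the family with centers $\gamma(s)$ and constant radius $r>0$ (a tubular hypersurface) if $\langle T-\gamma,T-\gamma\rangle=\lambda r^2$ and $T(s,t,w)-\gamma(s)$ is normal to the hypersurface (in particular $\langle T-\gamma,\partial T/\partial s\rangle=0$). $f=f(t,w)$ and $g=g(t,w)$ are smooth real functions with $g$ nowhere zero; $\mp$ means either sign may be chosen.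
   Formalization: "Can be parametrized" is proved locally, up to reparametrization, for regular hypersurfaces; for pseudo hyperspheres only at points where the F2- and F4-coefficients of T−γ are both nonzero (shown dense), as T1–T3 fail elsewhere; for T3 the sign is determined by the point. *)

theory Defs
  imports "HOL-Analysis.Analysis"
begin

text \<open>Smoothness, meant for open \<open>S\<close>: every iterated directional derivative exists
  and is continuous, to all orders.\<close>

primrec times_differentiable_on ::
  "nat \<Rightarrow> 'a::real_normed_vector set \<Rightarrow> ('a \<Rightarrow> 'b::real_normed_vector) \<Rightarrow> bool" where
  "times_differentiable_on 0 S f \<longleftrightarrow> continuous_on S f"
| "times_differentiable_on (Suc n) S f \<longleftrightarrow>
     (\<forall>x\<in>S. f differentiable (at x)) \<and>
     (\<forall>v. times_differentiable_on n S (\<lambda>x. frechet_derivative f (at x) v))"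

definition smooth_on ::
  "'a::real_normed_vector set \<Rightarrow> ('a \<Rightarrow> 'b::real_normed_vector) \<Rightarrow> bool" where
  "smooth_on S f \<longleftrightarrow> (\<forall>n. times_differentiable_on n S f)"

definition diffeomorphism_between ::
  "'a::real_normed_vector set \<Rightarrow> 'b::real_normed_vector set \<Rightarrow> ('a \<Rightarrow> 'b) \<Rightarrow> bool" where
  "diffeomorphism_between V W \<phi> \<longleftrightarrow>
     (\<exists>\<psi>. homeomorphism V W \<phi> \<psi> \<and> smooth_on V \<phi> \<and> smooth_on W \<psi>)"

definition mink :: "real^4 \<Rightarrow> real^4 \<Rightarrow> real" where
  "mink u v = - (u$1 * v$1) + u$2 * v$2 + u$3 * v$3 + u$4 * v$4"

definition null_vector :: "real^4 \<Rightarrow> bool" where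
  "null_vector v \<longleftrightarrow> v \<noteq> 0 \<and> mink v v = 0"

definition pseudo_hypersphere :: "real \<Rightarrow> real^4 \<Rightarrow> (real^4) set" where
  "pseudo_hypersphere r p = {u. mink (u - p) (u - p) = r\<^sup>2}"

definition pseudo_hyperbolic_hypersphere :: "real \<Rightarrow> real^4 \<Rightarrow> (real^4) set" where
  "pseudo_hyperbolic_hypersphere r p = {u. mink (u - p) (u - p) = - r\<^sup>2}"

definition straight_line_on :: "real set \<Rightarrow> (real \<Rightarrow> real^4) \<Rightarrow> bool" where
  "straight_line_on I \<gamma> \<longleftrightarrow> (\<exists>p v. \<forall>s\<in>I. \<gamma> s = p + s *\<^sub>R v)"

text \<open>A straight line has no principal normal of its own; by convention it is admitted,
  with \<open>k1 = 0\<close> in the Frenet equations below.\<close>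

definition pseudo_null_curve :: "real set \<Rightarrow> (real \<Rightarrow> real^4) \<Rightarrow> bool" where
  "pseudo_null_curve I \<gamma> \<longleftrightarrow>
     open I \<and> is_interval I \<and> I \<noteq> {} \<and> smooth_on I \<gamma> \<and>
     (\<forall>s\<in>I. mink (vector_derivative \<gamma> (at s)) (vector_derivative \<gamma> (at s)) = 1) \<and>
     (straight_line_on I \<gamma> \<or>
      (\<forall>s\<in>I. null_vector (vector_derivative (\<lambda>x. vector_derivative \<gamma> (at x)) (at s))))"

definition pseudo_null_frenet_frame ::
  "real set \<Rightarrow> (real \<Rightarrow> real^4) \<Rightarrow> (real \<Rightarrow> real^4) \<Rightarrow> (real \<Rightarrow> real^4) \<Rightarrow> (real \<Rightarrow> real^4) \<Rightarrow>
   (real \<Rightarrow> real^4) \<Rightarrow> real \<Rightarrow> (real \<Rightarrow> real) \<Rightarrow> (real \<Rightarrow> real) \<Rightarrow> bool" where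
  "pseudo_null_frenet_frame I \<gamma> F1 F2 F3 F4 k1 k2 k3 \<longleftrightarrow>
     smooth_on I F1 \<and> smooth_on I F2 \<and> smooth_on I F3 \<and> smooth_on I F4 \<and>
     smooth_on I k2 \<and> smooth_on I k3 \<and>
     k1 = (if straight_line_on I \<gamma> then 0 else 1) \<and>
     (\<forall>s\<in>I.
        (\<gamma> has_vector_derivative F1 s) (at s) \<and>
        (F1 has_vector_derivative k1 *\<^sub>R F2 s) (at s) \<and>
        (F2 has_vector_derivative k2 s *\<^sub>R F3 s) (at s) \<and>
        (F3 has_vector_derivative k3 s *\<^sub>R F2 s - k2 s *\<^sub>R F4 s) (at s) \<and>
        (F4 has_vector_derivative - (k1 *\<^sub>R F1 s) - k3 s *\<^sub>R F3 s) (at s) \<and>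
        mink (F1 s) (F1 s) = 1 \<and> mink (F3 s) (F3 s) = 1 \<and> mink (F2 s) (F4 s) = 1 \<and>
        mink (F2 s) (F2 s) = 0 \<and> mink (F4 s) (F4 s) = 0 \<and>
        mink (F1 s) (F2 s) = 0 \<and> mink (F1 s) (F3 s) = 0 \<and> mink (F1 s) (F4 s) = 0 \<and>
        mink (F2 s) (F3 s) = 0 \<and> mink (F3 s) (F4 s) = 0)"

text \<open>A parametrized hypersurface is a map of \<open>(s, t, w)\<close>. In the next definition \<open>Q p\<close> is the
  quadric of the family with center \<open>p\<close>, and the last conjunct says that \<open>T - \<gamma>\<close> is orthogonal
  to all tangent vectors, in particular to the three partial derivatives of \<open>T\<close>.\<close>

definition tubular_envelope ::
  "(real^4 \<Rightarrow> (real^4) set) \<Rightarrow> real set \<Rightarrow> (real \<Rightarrow> real^4) \<Rightarrow>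
   (real \<times> real \<times> real) set \<Rightarrow> (real \<times> real \<times> real \<Rightarrow> real^4) \<Rightarrow> bool" where
  "tubular_envelope Q I \<gamma> U T \<longleftrightarrow>
     open U \<and> U \<subseteq> I \<times> UNIV \<and> smooth_on U T \<and>
     (\<forall>x\<in>U. T x \<in> Q (\<gamma> (fst x)) \<and>
        (\<forall>v. mink (T x - \<gamma> (fst x)) (frechet_derivative T (at x) v) = 0))"

definition regular_on ::
  "(real \<times> real \<times> real) set \<Rightarrow> (real \<times> real \<times> real \<Rightarrow> real^4) \<Rightarrow> bool" where
  "regular_on U T \<longleftrightarrow> (\<forall>x\<in>U. inj (frechet_derivative T (at x)))"

definition admissible_pair ::
  "(real \<times> real) set \<Rightarrow> (real \<times> real \<Rightarrow> real) \<Rightarrow> (real \<times> real \<Rightarrow> real) \<Rightarrow> bool" where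
  "admissible_pair D f g \<longleftrightarrow>
     open D \<and> smooth_on D f \<and> smooth_on D g \<and> (\<forall>z\<in>D. g z \<noteq> 0)"

text \<open>\<open>X f g\<close> stands for one of the explicit parametrizations below. Near \<open>x\<close>, the
  hypersurface \<open>T\<close> is a reparametrization of \<open>X f g\<close> for suitable \<open>f\<close>, \<open>g\<close>; the change of
  parameters keeps \<open>s\<close>, so that corresponding points have the same center.\<close>

definition parametrizable_near ::
  "((real \<times> real \<Rightarrow> real) \<Rightarrow> (real \<times> real \<Rightarrow> real) \<Rightarrow> real \<times> real \<times> real \<Rightarrow> real^4) \<Rightarrow>
   (real \<times> real \<times> real) set \<Rightarrow> (real \<times> real \<times> real \<Rightarrow> real^4) \<Rightarrow> real \<times> real \<times> real \<Rightarrow> bool" where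
  "parametrizable_near X U T x \<longleftrightarrow>
     (\<exists>V J D f g \<phi>.
        open V \<and> x \<in> V \<and> V \<subseteq> U \<and> open J \<and> is_interval J \<and> admissible_pair D f g \<and>
        diffeomorphism_between V (J \<times> D) \<phi> \<and>
        (\<forall>y\<in>V. fst (\<phi> y) = fst y \<and> T y = X f g (\<phi> y)))"

text \<open>The explicit parametrizations; \<open>\<epsilon>\<close> ranges over \<open>{1, -1}\<close> and encodes the free sign.\<close>

definition tube1 where
  "tube1 \<epsilon> r \<gamma> F2 F3 F4 f g = (\<lambda>(s::real, t::real, w::real).
     (\<gamma> s :: real^4) - (\<epsilon> * r :: real) *\<^sub>R
       ((g (t, w) * sin (f (t, w))) *\<^sub>R F2 s + cos (f (t, w)) *\<^sub>R F3 s
        + (sin (f (t, w)) / (2 * g (t, w))) *\<^sub>R F4 s))"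

definition tube2 where
  "tube2 \<epsilon> r \<gamma> F2 F3 F4 f g = (\<lambda>(s::real, t::real, w::real).
     (\<gamma> s :: real^4) - (\<epsilon> * r :: real) *\<^sub>R
       ((g (t, w) * cos (f (t, w))) *\<^sub>R F2 s + sin (f (t, w)) *\<^sub>R F3 s
        + (cos (f (t, w)) / (2 * g (t, w))) *\<^sub>R F4 s))"

definition tube3 where
  "tube3 \<epsilon> r \<gamma> F2 F3 F4 f g = (\<lambda>(s::real, t::real, w::real).
     (\<gamma> s :: real^4) - (\<epsilon> * r :: real) *\<^sub>R
       ((g (t, w) * sinh (f (t, w))) *\<^sub>R F2 s + cosh (f (t, w)) *\<^sub>R F3 s
        - (sinh (f (t, w)) / (2 * g (t, w))) *\<^sub>R F4 s))"

definition tube4 where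
  "tube4 \<epsilon> r \<gamma> F2 F3 F4 f g = (\<lambda>(s::real, t::real, w::real).
     (\<gamma> s :: real^4) - (\<epsilon> * r :: real) *\<^sub>R
       ((g (t, w) * cosh (f (t, w))) *\<^sub>R F2 s + sinh (f (t, w)) *\<^sub>R F3 s
        - (cosh (f (t, w)) / (2 * g (t, w))) *\<^sub>R F4 s))"

text \<open>If \<open>v = a2 F2 + a3 F3 + a4 F4\<close>, then \<open>a2 = mink v (F4 s)\<close> and \<open>a4 = mink v (F2 s)\<close>, so for
  \<open>v = T x - \<gamma> s\<close> the next value is \<open>a2 * a4\<close>. On a pseudo hypersphere
  \<open>a3\<^sup>2 + 2 * a2 * a4 = r\<^sup>2\<close>: the circular forms reach \<open>a2 * a4 > 0\<close> and the hyperbolic form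
  reaches \<open>a2 * a4 < 0\<close>, while none of them reaches the points with exactly one of
  \<open>a2\<close>, \<open>a4\<close> equal to zero.\<close>

definition null_coord_product ::
  "(real \<Rightarrow> real^4) \<Rightarrow> (real \<Rightarrow> real^4) \<Rightarrow> (real \<Rightarrow> real^4) \<Rightarrow>
   (real \<times> real \<times> real \<Rightarrow> real^4) \<Rightarrow> real \<times> real \<times> real \<Rightarrow> real" where
  "null_coord_product \<gamma> F2 F4 T x =
     mink (T x - \<gamma> (fst x)) (F4 (fst x)) * mink (T x - \<gamma> (fst x)) (F2 (fst x))"

end

theory Submission
  imports Defs
begin

text \<open>Write \<open>N = T - \<gamma>\<close>. Differentiating \<open>mink N N = c\<close> shows that, for a map into the quadrics
centered on the curve, \<open>N\<close> is normal to the hypersurface if and only if it is orthogonal to the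
tangent \<open>F1\<close> of the curve (\<open>tubular_envelope_iff\<close>). The tubular envelopes are therefore the
maps \<open>T = \<gamma> + a2 F2 + a3 F3 + a4 F4\<close> with \<open>a3\<^sup>2 + 2 a2 a4 = c\<close>, where \<open>c = \<plusminus> r\<^sup>2\<close>.

Each of the four parametrizations is an instance of \<open>tube\<close>, in which \<open>a3\<close> is a multiple of
\<open>C f\<close> and \<open>a2 a4\<close> a multiple of \<open>(S f)\<^sup>2\<close>; the equation of the quadric is then the Pythagorean
identity for the circular or hyperbolic pair \<open>(S, C)\<close> (\<open>tubular_envelope_tube\<close>).

Conversely, the equation of the quadric relates the sign of \<open>a2 a4\<close> to the size of \<open>a3\<close> and so
tells which function \<open>C\<close> attains the value of \<open>a3\<close>. Its inverse function yields \<open>f\<close>, and \<open>a2\<close>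
yields \<open>g\<close>. The map sending \<open>(s, t, w)\<close> to \<open>(s, f, g)\<close> is an immersion because \<open>T\<close>, which
factors through it, is regular; the smooth inverse function theorem
(\<open>smooth_inverse_function\<close>) makes it the required local change of parameters
(\<open>parametrizable_near_tube\<close>). The smoothness of \<open>f\<close> and \<open>g\<close> rests on that of the
inverse circular and hyperbolic functions.

Points with \<open>a2 a4 = 0\<close> on a pseudo hypersphere cannot fill an open set: there \<open>a3\<close> would be
constant and one of \<open>a2\<close>, \<open>a4\<close> zero, leaving a single function of the parameters to move the
point for fixed \<open>s\<close>, against regularity (\<open>nondegenerate_dense\<close>).\<close>

section \<open>Calculus of finitely often differentiable maps\<close>

lemma times_differentiable_on_subset:
  "times_differentiable_on n S f \<Longrightarrow> T \<subseteq> S \<Longrightarrow> times_differentiable_on n T f"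
proof (induction n arbitrary: f)
  case 0
  then show ?case by (auto intro: continuous_on_subset)
next
  case (Suc n)
  then show ?case by (auto simp: subset_iff)
qed

lemma times_differentiable_on_cong:
  assumes "open S" "times_differentiable_on n S g" "\<And>x. x \<in> S \<Longrightarrow> f x = g x"
  shows "times_differentiable_on n S f"
  using assms(2,3)
proof (induction n arbitrary: f g)
  case 0
  then show ?case by (simp cong: continuous_on_cong)
next
  case (Suc n)
  have der: "(f has_derivative frechet_derivative g (at x)) (at x)" if "x \<in> S" for x
  proof (rule has_derivative_transform_within_open[OF _ \<open>open S\<close> that])
    show "(g has_derivative frechet_derivative g (at x)) (at x)"
      using Suc.prems(1) that by (simp add: frechet_derivative_works)
  qed (use Suc.prems in auto)
  have "times_differentiable_on n S (\<lambda>x. frechet_derivative f (at x) v)" for v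
  proof (rule Suc.IH)
    show "times_differentiable_on n S (\<lambda>x. frechet_derivative g (at x) v)"
      using Suc.prems by simp
    show "frechet_derivative f (at x) v = frechet_derivative g (at x) v" if "x \<in> S" for x
      using frechet_derivative_at[OF der[OF that]] by simp
  qed
  then show ?case using der by (auto simp: differentiable_def)
qed

lemma times_differentiable_on_SucI:
  assumes "open S"
    and "\<And>x. x \<in> S \<Longrightarrow> (f has_derivative f' x) (at x)"
    and "\<And>v. times_differentiable_on n S (\<lambda>x. f' x v)"
  shows "times_differentiable_on (Suc n) S f"
proof -
  have "times_differentiable_on n S (\<lambda>x. frechet_derivative f (at x) v)" for v
    by (rule times_differentiable_on_cong[OF assms(1,3)])
      (simp add: frechet_derivative_at[OF assms(2), symmetric])
  then show ?thesis using assms(2) by (auto simp: differentiable_def)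
qed

lemma times_differentiable_on_SucD:
  assumes "times_differentiable_on (Suc n) S f"
  shows "x \<in> S \<Longrightarrow> (f has_derivative frechet_derivative f (at x)) (at x)"
    and "times_differentiable_on n S (\<lambda>x. frechet_derivative f (at x) v)"
  using assms by (auto simp: frechet_derivative_works)

lemma times_differentiable_on_Suc_imp:
  assumes "times_differentiable_on (Suc n) S f"
  shows "times_differentiable_on n S f"
  using assms
proof (induction n arbitrary: f)
  case 0
  then show ?case
    by (auto intro!: continuous_at_imp_continuous_on differentiable_imp_continuous_within)
next
  case (Suc n)
  then show ?case by (metis times_differentiable_on.simps(2))
qed

lemma times_differentiable_on_const: "times_differentiable_on n S (\<lambda>x. c)"
  by (induction n arbitrary: c) auto

lemma times_differentiable_on_linear:
  assumes "open S" "bounded_linear L"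
  shows "times_differentiable_on n S L"
proof (cases n)
  case 0
  then show ?thesis using assms(2) by (simp add: linear_continuous_on)
next
  case (Suc m)
  show ?thesis unfolding Suc
    by (rule times_differentiable_on_SucI[OF assms(1) bounded_linear_imp_has_derivative[OF assms(2)]])
      (rule times_differentiable_on_const)
qed

lemma times_differentiable_on_linear_compose:
  assumes "open S" "bounded_linear L" "times_differentiable_on n S f"
  shows "times_differentiable_on n S (\<lambda>x. L (f x))"
  using assms(3)
proof (induction n arbitrary: f)
  case 0
  then show ?case
    using bounded_linear.continuous_on[OF assms(2)] by auto
next
  case (Suc n)
  show ?case
    by (rule times_differentiable_on_SucI[OF \<open>open S\<close>
          bounded_linear.has_derivative[OF assms(2) times_differentiable_on_SucD(1)[OF Suc.prems]]])
      (use Suc in auto)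
qed

lemma times_differentiable_on_add:
  assumes "open S" "times_differentiable_on n S f" "times_differentiable_on n S g"
  shows "times_differentiable_on n S (\<lambda>x. f x + g x)"
  using assms(2,3)
proof (induction n arbitrary: f g)
  case 0
  then show ?case by (auto intro: continuous_on_add)
next
  case (Suc n)
  show ?case
    by (rule times_differentiable_on_SucI[OF \<open>open S\<close> has_derivative_add])
      (use Suc in \<open>auto simp: frechet_derivative_works\<close>)
qed

lemma times_differentiable_on_sum:
  assumes "open S" "\<And>i. i \<in> A \<Longrightarrow> times_differentiable_on n S (f i)"
  shows "times_differentiable_on n S (\<lambda>x. \<Sum>i\<in>A. f i x)"
  using assms(2)
  by (induction A rule: infinite_finite_induct)
    (auto intro!: times_differentiable_on_add times_differentiable_on_const assms(1))

lemma times_differentiable_on_bilinear: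
  assumes "open S" "bounded_bilinear h"
    and "times_differentiable_on n S f" "times_differentiable_on n S g"
  shows "times_differentiable_on n S (\<lambda>x. h (f x) (g x))"
  using assms(3,4)
proof (induction n arbitrary: f g)
  case 0
  then show ?case using bounded_bilinear.continuous_on[OF assms(2)] by auto
next
  case (Suc n)
  show ?case
  proof (rule times_differentiable_on_SucI[OF \<open>open S\<close>])
    show "((\<lambda>x. h (f x) (g x)) has_derivative
      (\<lambda>v. h (f x) (frechet_derivative g (at x) v) + h (frechet_derivative f (at x) v) (g x))) (at x)"
      if "x \<in> S" for x
      by (rule bounded_bilinear.FDERIV[OF assms(2)])
        (use Suc.prems that in \<open>auto simp: frechet_derivative_works\<close>)
    show "times_differentiable_on n S (\<lambda>x. h (f x) (frechet_derivative g (at x) v)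
        + h (frechet_derivative f (at x) v) (g x))" for v
      by (intro times_differentiable_on_add Suc.IH times_differentiable_on_Suc_imp[OF Suc.prems(1)]
          times_differentiable_on_Suc_imp[OF Suc.prems(2)] times_differentiable_on_SucD(2)[OF Suc.prems(1)]
          times_differentiable_on_SucD(2)[OF Suc.prems(2)] \<open>open S\<close>)
  qed
qed

text \<open>The chain rule yields derivatives \<open>L x (w x)\<close> in which both the linear map and the
vector depend on \<open>x\<close>, whereas the definition of \<open>times_differentiable_on\<close> only speaks of
fixed directions. Expanding \<open>w x\<close> in the standard basis reduces the first to the second;
this is where a finite-dimensional middle space is used.\<close>
lemma times_differentiable_on_apply_linear:
  fixes L :: "'a::real_normed_vector \<Rightarrow> 'b::euclidean_space \<Rightarrow> 'c::real_normed_vector"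
  assumes "open S" "\<And>x. x \<in> S \<Longrightarrow> linear (L x)"
    and L: "\<And>b. times_differentiable_on n S (\<lambda>x. L x b)"
    and w: "times_differentiable_on n S w"
  shows "times_differentiable_on n S (\<lambda>x. L x (w x))"
proof (rule times_differentiable_on_cong[OF \<open>open S\<close>])
  show "times_differentiable_on n S (\<lambda>x. \<Sum>b\<in>Basis. (w x \<bullet> b) *\<^sub>R L x b)"
    by (intro times_differentiable_on_sum times_differentiable_on_bilinear[OF _ bounded_bilinear_scaleR]
        times_differentiable_on_bilinear[OF _ bounded_bilinear_inner] times_differentiable_on_const
        L w \<open>open S\<close>)
  show "L x (w x) = (\<Sum>b\<in>Basis. (w x \<bullet> b) *\<^sub>R L x b)" if "x \<in> S" for x
  proof -
    have "L x (w x) = L x (\<Sum>b\<in>Basis. (w x \<bullet> b) *\<^sub>R b)" by (simp only: euclidean_representation)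
    also have "\<dots> = (\<Sum>b\<in>Basis. (w x \<bullet> b) *\<^sub>R L x b)"
      using assms(2)[OF that] by (simp add: linear_sum linear_cmul)
    finally show ?thesis .
  qed
qed

lemma times_differentiable_on_compose:
  fixes g :: "'a::real_normed_vector \<Rightarrow> 'b::euclidean_space"
  assumes "open S" "open T" "times_differentiable_on n S g" "times_differentiable_on n T f" "g ` S \<subseteq> T"
  shows "times_differentiable_on n S (\<lambda>x. f (g x))"
  using assms(3,4)
proof (induction n arbitrary: f)
  case 0
  then show ?case using assms(5) continuous_on_compose2 by auto
next
  case (Suc n)
  have Df: "(f has_derivative frechet_derivative f (at (g x))) (at (g x))" if "x \<in> S" for x
    using Suc.prems(2) assms(5) that by (intro times_differentiable_on_SucD(1)) auto
  show ?case
  proof (rule times_differentiable_on_SucI[OF \<open>open S\<close>])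
    show "((\<lambda>x. f (g x)) has_derivative
        (\<lambda>v. frechet_derivative f (at (g x)) (frechet_derivative g (at x) v))) (at x)" if "x \<in> S" for x
      by (rule has_derivative_compose[OF times_differentiable_on_SucD(1)[OF Suc.prems(1) that] Df[OF that]])
    show "times_differentiable_on n S
        (\<lambda>x. frechet_derivative f (at (g x)) (frechet_derivative g (at x) v))" for v
    proof (rule times_differentiable_on_apply_linear[OF \<open>open S\<close>])
      show "linear (frechet_derivative f (at (g x)))" if "x \<in> S" for x
        using has_derivative_linear[OF Df[OF that]] .
      show "times_differentiable_on n S (\<lambda>x. frechet_derivative f (at (g x)) b)" for b
        by (rule Suc.IH) (use Suc.prems times_differentiable_on_Suc_imp in auto)
    qed (use Suc.prems in auto)
  qed
qed

section \<open>Smooth maps\<close>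

lemma smooth_on_has_derivative:
  "smooth_on S f \<Longrightarrow> x \<in> S \<Longrightarrow> (f has_derivative frechet_derivative f (at x)) (at x)"
  unfolding smooth_on_def by (blast intro: times_differentiable_on_SucD(1))

lemma smooth_on_frechet_derivative:
  "smooth_on S f \<Longrightarrow> smooth_on S (\<lambda>x. frechet_derivative f (at x) v)"
  unfolding smooth_on_def by (blast intro: times_differentiable_on_SucD(2))

lemma smooth_on_imp_continuous_on: "smooth_on S f \<Longrightarrow> continuous_on S f"
  unfolding smooth_on_def by (metis times_differentiable_on.simps(1))

lemma smooth_on_subset: "smooth_on S f \<Longrightarrow> T \<subseteq> S \<Longrightarrow> smooth_on T f"
  unfolding smooth_on_def by (blast intro: times_differentiable_on_subset)

lemma smooth_on_const: "smooth_on S (\<lambda>x. c)"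
  unfolding smooth_on_def by (blast intro: times_differentiable_on_const)

lemma smooth_on_linear: "open S \<Longrightarrow> bounded_linear L \<Longrightarrow> smooth_on S L"
  unfolding smooth_on_def by (blast intro: times_differentiable_on_linear)

lemma smooth_on_add:
  "open S \<Longrightarrow> smooth_on S f \<Longrightarrow> smooth_on S g \<Longrightarrow> smooth_on S (\<lambda>x. f x + g x)"
  unfolding smooth_on_def by (blast intro: times_differentiable_on_add)

lemma smooth_on_bilinear:
  "bounded_bilinear h \<Longrightarrow> open S \<Longrightarrow> smooth_on S f \<Longrightarrow> smooth_on S g \<Longrightarrow> smooth_on S (\<lambda>x. h (f x) (g x))"
  unfolding smooth_on_def by (blast intro: times_differentiable_on_bilinear)

lemmas smooth_on_scaleR = smooth_on_bilinear[OF bounded_bilinear_scaleR]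

lemma smooth_on_mult:
  fixes f g :: "'a::real_normed_vector \<Rightarrow> real"
  shows "open S \<Longrightarrow> smooth_on S f \<Longrightarrow> smooth_on S g \<Longrightarrow> smooth_on S (\<lambda>x. f x * g x)"
  using smooth_on_bilinear[OF bounded_bilinear_mult] .

lemma smooth_on_minus: "open S \<Longrightarrow> smooth_on S f \<Longrightarrow> smooth_on S (\<lambda>x. - f x)"
  unfolding smooth_on_def
  by (blast intro: times_differentiable_on_linear_compose bounded_linear_minus[OF bounded_linear_ident])

lemma smooth_on_diff:
  "open S \<Longrightarrow> smooth_on S f \<Longrightarrow> smooth_on S g \<Longrightarrow> smooth_on S (\<lambda>x. f x - g x)"
  using smooth_on_add[of S f "\<lambda>x. - g x"] smooth_on_minus[of S g] by simp

lemma smooth_on_compose: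
  fixes g :: "'a::real_normed_vector \<Rightarrow> 'b::euclidean_space"
  shows "smooth_on T f \<Longrightarrow> open T \<Longrightarrow> open S \<Longrightarrow> smooth_on S g \<Longrightarrow> (\<And>x. x \<in> S \<Longrightarrow> g x \<in> T)
    \<Longrightarrow> smooth_on S (\<lambda>x. f (g x))"
  unfolding smooth_on_def by (blast intro: times_differentiable_on_compose)

lemma smooth_on_Pair:
  assumes "open S" "smooth_on S f" "smooth_on S g"
  shows "smooth_on S (\<lambda>x. (f x, g x))"
proof -
  have "bounded_linear (\<lambda>x::'b. (x, 0::'c))" "bounded_linear (\<lambda>y::'c. (0::'b, y))"
    by (intro bounded_linear_Pair bounded_linear_ident bounded_linear_zero)+
  then have "smooth_on S (\<lambda>x. (f x, 0::'c))" "smooth_on S (\<lambda>x. (0::'b, g x))"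
    using assms times_differentiable_on_linear_compose[of S] unfolding smooth_on_def by blast+
  then show ?thesis
    using smooth_on_add[OF assms(1), of "\<lambda>x. (f x, 0)" "\<lambda>x. (0, g x)"] by simp
qed

lemma times_differentiable_on_real_SucI:
  fixes f :: "real \<Rightarrow> real"
  assumes "open S" "\<And>x. x \<in> S \<Longrightarrow> (f has_real_derivative f' x) (at x)"
    and "times_differentiable_on n S f'"
  shows "times_differentiable_on (Suc n) S f"
  by (rule times_differentiable_on_SucI[OF \<open>open S\<close>, where f' = "\<lambda>x v. f' x * v"])
    (use assms in \<open>auto simp: has_field_derivative_def intro!: times_differentiable_on_const
        times_differentiable_on_bilinear[OF _ bounded_bilinear_mult]\<close>)

text \<open>This transfers smoothness from \<open>1 / sqrt p\<close>, with \<open>p\<close> a quadratic polynomial, to the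
inverse circular and hyperbolic functions.\<close>
lemma smooth_on_real_antiderivative:
  fixes f :: "real \<Rightarrow> real"
  assumes "open S" "\<And>x. x \<in> S \<Longrightarrow> (f has_real_derivative f' x) (at x)" and "smooth_on S f'"
  shows "smooth_on S f"
  unfolding smooth_on_def
proof
  show "times_differentiable_on n S f" for n
    using times_differentiable_on_real_SucI[OF assms(1,2)] assms(3)
    unfolding smooth_on_def by (blast intro: times_differentiable_on_Suc_imp)
qed

lemma smooth_on_sin_cos: "smooth_on UNIV (sin :: real \<Rightarrow> real)" "smooth_on UNIV (cos :: real \<Rightarrow> real)"
proof -
  have "times_differentiable_on n UNIV (sin :: real \<Rightarrow> real) \<and>
      times_differentiable_on n UNIV (cos :: real \<Rightarrow> real)" for n
  proof (induction n)
    case 0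
    then show ?case by (auto intro: continuous_intros)
  next
    case (Suc n)
    have "times_differentiable_on n UNIV (\<lambda>x::real. - sin x)"
      using Suc by (intro times_differentiable_on_linear_compose[OF open_UNIV
          bounded_linear_minus[OF bounded_linear_ident]]) auto
    then show ?case using Suc
      by (auto simp del: times_differentiable_on.simps intro!: derivative_eq_intros
          times_differentiable_on_real_SucI[of _ sin cos] times_differentiable_on_real_SucI[of _ cos "\<lambda>x. - sin x"])
  qed
  then show "smooth_on UNIV (sin :: real \<Rightarrow> real)" "smooth_on UNIV (cos :: real \<Rightarrow> real)"
    by (auto simp: smooth_on_def)
qed

lemma smooth_on_sinh_cosh:
  "smooth_on UNIV (sinh :: real \<Rightarrow> real)" "smooth_on UNIV (cosh :: real \<Rightarrow> real)"
proof -
  have "times_differentiable_on n UNIV (sinh :: real \<Rightarrow> real) \<and>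
      times_differentiable_on n UNIV (cosh :: real \<Rightarrow> real)" for n
  proof (induction n)
    case 0
    then show ?case by (auto intro: continuous_intros)
  next
    case (Suc n)
    then show ?case
      by (auto simp del: times_differentiable_on.simps intro!: derivative_eq_intros
          times_differentiable_on_real_SucI[of _ sinh cosh] times_differentiable_on_real_SucI[of _ cosh sinh])
  qed
  then show "smooth_on UNIV (sinh :: real \<Rightarrow> real)" "smooth_on UNIV (cosh :: real \<Rightarrow> real)"
    by (auto simp: smooth_on_def)
qed

lemma smooth_on_inverse: "smooth_on (- {0}) (inverse :: real \<Rightarrow> real)"
proof -
  have op: "open (- {0::real})" by auto
  have "times_differentiable_on n (- {0}) (inverse :: real \<Rightarrow> real)" for n
  proof (induction n)
    case 0
    then show ?case by (auto intro: continuous_intros)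
  next
    case (Suc n)
    have "times_differentiable_on n (- {0}) (\<lambda>x::real. - (inverse x * inverse x))"
      by (intro times_differentiable_on_linear_compose[OF op bounded_linear_minus[OF bounded_linear_ident]]
          times_differentiable_on_bilinear[OF op bounded_bilinear_mult] Suc)
    then show ?case
      by (rule times_differentiable_on_real_SucI[OF op, rotated]) (auto intro!: derivative_eq_intros)
  qed
  then show ?thesis by (simp add: smooth_on_def)
qed

lemma smooth_on_divide:
  fixes f g :: "'a::real_normed_vector \<Rightarrow> real"
  assumes "open S" "smooth_on S f" "smooth_on S g" "\<And>x. x \<in> S \<Longrightarrow> g x \<noteq> 0"
  shows "smooth_on S (\<lambda>x. f x / g x)"
proof -
  have "smooth_on S (\<lambda>x. inverse (g x))"
    by (rule smooth_on_compose[OF smooth_on_inverse]) (use assms in auto)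
  from smooth_on_mult[OF assms(1,2) this] show ?thesis by (simp add: field_simps)
qed

lemma smooth_on_sqrt: "smooth_on {0<..} sqrt"
proof -
  have op: "open {0::real<..}" by auto
  have "times_differentiable_on n {0<..} sqrt" for n
  proof (induction n)
    case 0
    then show ?case by (auto intro: continuous_intros)
  next
    case (Suc n)
    have "times_differentiable_on n {0<..} (\<lambda>x. inverse (sqrt x))"
      by (rule times_differentiable_on_compose[where T = "- {0}", OF op _ Suc])
        (use smooth_on_inverse in \<open>auto simp: smooth_on_def\<close>)
    then have "times_differentiable_on n {0<..} (\<lambda>x. inverse (sqrt x) * inverse 2)"
      by (intro times_differentiable_on_bilinear[OF op bounded_bilinear_mult] times_differentiable_on_const)
    then show ?case
      by (rule times_differentiable_on_real_SucI[OF op, rotated])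
        (auto intro!: derivative_eq_intros simp: divide_simps)
  qed
  then show ?thesis by (simp add: smooth_on_def)
qed

lemma smooth_on_inverse_sqrt:
  fixes p :: "'a::real_normed_vector \<Rightarrow> real"
  assumes "open S" "smooth_on S p" "\<And>x. x \<in> S \<Longrightarrow> p x > 0"
  shows "smooth_on S (\<lambda>x. 1 / sqrt (p x))"
proof (intro smooth_on_divide smooth_on_const assms)
  show "smooth_on S (\<lambda>x. sqrt (p x))"
    by (rule smooth_on_compose[OF smooth_on_sqrt]) (use assms in auto)
  show "sqrt (p x) \<noteq> 0" if "x \<in> S" for x using assms(3)[OF that] by simp
qed

lemma smooth_on_square: "open S \<Longrightarrow> smooth_on S (\<lambda>x::real. x\<^sup>2)"
  unfolding power2_eq_square
  by (intro smooth_on_mult smooth_on_linear bounded_linear_ident)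

lemma smooth_on_arcsin: "smooth_on {-1<..<1} arcsin"
proof (rule smooth_on_real_antiderivative)
  have "x\<^sup>2 < 1" if "x \<in> {-1<..<1}" for x :: real using that by (auto simp: abs_square_less_1 abs_less_iff)
  then show "smooth_on {-1<..<1} (\<lambda>x::real. 1 / sqrt (1 - x\<^sup>2))"
    by (intro smooth_on_inverse_sqrt smooth_on_diff smooth_on_const smooth_on_square) auto
qed (auto intro!: derivative_eq_intros simp: divide_simps)

lemma smooth_on_arccos: "smooth_on {-1<..<1} arccos"
proof (rule smooth_on_real_antiderivative)
  have "x\<^sup>2 < 1" if "x \<in> {-1<..<1}" for x :: real using that by (auto simp: abs_square_less_1 abs_less_iff)
  then show "smooth_on {-1<..<1} (\<lambda>x::real. - (1 / sqrt (1 - x\<^sup>2)))"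
    by (intro smooth_on_minus smooth_on_inverse_sqrt smooth_on_diff smooth_on_const smooth_on_square) auto
qed (auto intro!: derivative_eq_intros simp: divide_simps)

lemma smooth_on_arsinh: "smooth_on UNIV (arsinh :: real \<Rightarrow> real)"
proof (rule smooth_on_real_antiderivative)
  show "smooth_on UNIV (\<lambda>x::real. 1 / sqrt (x\<^sup>2 + 1))"
    by (intro smooth_on_inverse_sqrt smooth_on_add smooth_on_const smooth_on_square) (auto intro: add_nonneg_pos)
qed (auto intro!: derivative_eq_intros)

lemma smooth_on_arcosh: "smooth_on {1<..} (arcosh :: real \<Rightarrow> real)"
proof (rule smooth_on_real_antiderivative)
  show "smooth_on {1<..} (\<lambda>x::real. 1 / sqrt (x\<^sup>2 - 1))"
    by (intro smooth_on_inverse_sqrt smooth_on_diff smooth_on_const smooth_on_square) (auto simp: one_less_power)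
qed (auto intro!: derivative_eq_intros)

section \<open>The inverse function theorem for smooth maps\<close>

text \<open>A product rule in which one factor is merely continuous: if the other factor vanishes at the
point, the increment of the continuous factor only enters in second order.\<close>
lemma has_derivative_scaleR_at_zero:
  fixes k :: "'a::real_normed_vector \<Rightarrow> real" and h :: "'a \<Rightarrow> 'b::real_normed_vector"
  assumes k: "(k has_derivative k') (at z)" and "k z = 0" and h: "isCont h z"
  shows "((\<lambda>y. k y *\<^sub>R h y) has_derivative (\<lambda>d. k' d *\<^sub>R h z)) (at z)"
proof -
  have "((\<lambda>y. k y *\<^sub>R (h y - h z)) has_derivative (\<lambda>d. 0)) (at z)"
    unfolding has_derivative_at_alt
  proof (intro conjI allI impI bounded_linear_zero)
    fix e :: real assume "e > 0"
    interpret bounded_linear k' using k by (rule has_derivative_bounded_linear)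
    obtain K where K: "K > 0" "\<And>v. norm (k' v) \<le> norm v * K" using pos_bounded by blast
    obtain d1 where d1: "d1 > 0" "\<And>y. norm (y - z) < d1 \<Longrightarrow> norm (k y - k z - k' (y - z)) \<le> 1 * norm (y - z)"
      using k unfolding has_derivative_at_alt by (meson zero_less_one)
    obtain d2 where d2: "d2 > 0" "\<And>y. norm (y - z) < d2 \<Longrightarrow> norm (h y - h z) < e / (1 + K)"
      using h \<open>e > 0\<close> K(1) unfolding continuous_at_eps_delta dist_norm
      by (metis add_pos_pos divide_pos_pos zero_less_one)
    show "\<exists>d>0. \<forall>y. norm (y - z) < d \<longrightarrow>
      norm (k y *\<^sub>R (h y - h z) - k z *\<^sub>R (h z - h z) - 0) \<le> e * norm (y - z)"
    proof (intro exI[of _ "min d1 d2"] conjI allI impI)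
      fix y assume y: "norm (y - z) < min d1 d2"
      have "\<bar>k y\<bar> \<le> (1 + K) * norm (y - z)"
        using d1(2)[of y] K(2)[of "y - z"] y \<open>k z = 0\<close> by (simp add: algebra_simps)
      then have "\<bar>k y\<bar> * norm (h y - h z) \<le> ((1 + K) * norm (y - z)) * (e / (1 + K))"
        using d2(2)[of y] y by (intro mult_mono) auto
      also have "\<dots> = e * norm (y - z)" using K(1) by (simp add: field_simps)
      finally show "norm (k y *\<^sub>R (h y - h z) - k z *\<^sub>R (h z - h z) - 0) \<le> e * norm (y - z)" by simp
    qed (use d1 d2 in auto)
  qed
  moreover have "((\<lambda>y. k y *\<^sub>R h z) has_derivative (\<lambda>d. k' d *\<^sub>R h z)) (at z)"
    using k by (auto intro!: derivative_eq_intros)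
  ultimately show ?thesis
    using has_derivative_add[of "\<lambda>y. k y *\<^sub>R (h y - h z)" "\<lambda>d. 0" "at z" "\<lambda>y. k y *\<^sub>R h z"]
    by (simp add: algebra_simps)
qed

text \<open>Pointwise continuity of a family of isomorphisms of a finite-dimensional space is continuity
in operator norm, so the lower bound \<open>norm (A z x) \<ge> c * norm x\<close> persists near \<open>z\<close> with
\<open>c / 2\<close>. Hence the inverses \<open>G y\<close> are uniformly bounded there, and
\<open>G y v - G z v = G y (v - A y (G z v))\<close> tends to zero.\<close>
lemma isCont_inverse_family:
  fixes A G :: "'a::real_normed_vector \<Rightarrow> 'b::euclidean_space \<Rightarrow> 'b"
  assumes "open W" "z \<in> W" and lin: "\<And>y. y \<in> W \<Longrightarrow> linear (A y)"
    and AG: "\<And>y v. y \<in> W \<Longrightarrow> A y (G y v) = v" and GA: "\<And>y v. y \<in> W \<Longrightarrow> G y (A y v) = v"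
    and cont: "\<And>u. isCont (\<lambda>y. A y u) z"
  shows "isCont (\<lambda>y. G y v) z"
proof -
  have "inj (A z)" using GA[OF \<open>z \<in> W\<close>] by (metis injI)
  then obtain c where c: "c > 0" "\<And>x. c * norm x \<le> norm (A z x)"
    using linear_inj_bounded_below_pos[OF lin[OF \<open>z \<in> W\<close>]] by blast
  define s where "s y = (\<Sum>b\<in>Basis. norm (A y b - A z b))" for y
  have "(s \<longlongrightarrow> 0) (at z)"
    unfolding s_def using cont by (intro tendsto_null_sum tendsto_norm_zero LIM_zero) (auto simp: isCont_def)
  then have "\<forall>\<^sub>F y in at z. s y < c / 2" by (rule order_tendstoD(2)) (use c in simp)
  moreover have "\<forall>\<^sub>F y in at z. y \<in> W" using assms(1,2) by (rule eventually_at_in_open')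
  ultimately have "\<forall>\<^sub>F y in at z. norm (G y v - G z v) \<le> (2 / c) * norm (v - A y (G z v))"
  proof eventually_elim
    case (elim y)
    have "norm (A y x - A z x) \<le> s y * norm x" for x
    proof -
      have ex: "B x = (\<Sum>b\<in>Basis. (x \<bullet> b) *\<^sub>R B b)" if "linear B" for B :: "'b \<Rightarrow> 'b"
        using that by (metis (no_types, lifting) euclidean_representation linear_cmul linear_sum sum.cong)
      have "A y x - A z x = (\<Sum>b\<in>Basis. (x \<bullet> b) *\<^sub>R (A y b - A z b))"
        using ex[OF lin[OF elim(2)]] ex[OF lin[OF \<open>z \<in> W\<close>]]
        by (simp add: scaleR_diff_right sum_subtractf)
      also have "norm \<dots> \<le> (\<Sum>b\<in>Basis. norm x * norm (A y b - A z b))"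
        by (rule order_trans[OF norm_sum sum_mono]) (auto intro!: mult_right_mono Basis_le_norm)
      finally show ?thesis by (simp add: s_def sum_distrib_left mult.commute)
    qed
    note close = this
    define x where "x = G y v - G z v"
    have "c * norm x \<le> norm (A y x) + norm (A y x - A z x)"
      using c(2)[of x] norm_triangle_ineq4[of "A y x" "A y x - A z x"] by simp
    also have "\<dots> \<le> norm (A y x) + (c / 2) * norm x"
      using close[of x] elim(1) mult_right_mono[of "s y" "c / 2" "norm x"] by simp
    finally have "norm x \<le> (2 / c) * norm (A y x)" using c(1) by (simp add: field_simps)
    moreover have "A y x = v - A y (G z v)"
      using AG[OF elim(2)] lin[OF elim(2)] by (simp add: x_def linear_diff)
    ultimately show ?case by (simp add: x_def)
  qed
  moreover have "((\<lambda>y. (2 / c) * norm (v - A y (G z v))) \<longlongrightarrow> 0) (at z)"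
  proof -
    have "((\<lambda>y. v - A y (G z v)) \<longlongrightarrow> v - A z (G z v)) (at z)"
      using cont[of "G z v"] by (intro tendsto_intros) (simp add: isCont_def)
    then show ?thesis
      using AG[OF \<open>z \<in> W\<close>] by (intro tendsto_mult_right_zero tendsto_norm_zero) simp
  qed
  ultimately have "((\<lambda>y. G y v - G z v) \<longlongrightarrow> 0) (at z)" by (rule Lim_null_comparison)
  then show ?thesis unfolding isCont_def by (rule LIM_zero_cancel)
qed

text \<open>This is the formula \<open>(A\<inverse>)' = - A\<inverse> A' A\<inverse>\<close>, evaluated at a vector. With
\<open>u = G z v\<close> fixed, \<open>G y v = u - G y (A y u - v)\<close>, and \<open>A y u - v\<close> vanishes at \<open>y = z\<close>;
continuity of \<open>G\<close> is therefore enough to differentiate the product.\<close>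
lemma has_derivative_inverse_family:
  fixes A G :: "'a::real_normed_vector \<Rightarrow> 'b::euclidean_space \<Rightarrow> 'b"
  assumes "open W" "z \<in> W" and lin: "\<And>y. y \<in> W \<Longrightarrow> linear (A y)" "\<And>y. y \<in> W \<Longrightarrow> linear (G y)"
    and AG: "\<And>y v. y \<in> W \<Longrightarrow> A y (G y v) = v" and GA: "\<And>y v. y \<in> W \<Longrightarrow> G y (A y v) = v"
    and der: "\<And>u. ((\<lambda>y. A y u) has_derivative A' u) (at z)"
  shows "((\<lambda>y. G y v) has_derivative (\<lambda>h. - G z (A' (G z v) h))) (at z)"
proof -
  define u where "u = G z v"
  have ex: "G y x = (\<Sum>b\<in>Basis. (x \<bullet> b) *\<^sub>R G y b)" if "y \<in> W" for x y
    using lin(2)[OF that]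
    by (metis (no_types, lifting) euclidean_representation linear_cmul linear_sum sum.cong)
  have "((\<lambda>y. \<Sum>b\<in>Basis. ((A y u - v) \<bullet> b) *\<^sub>R G y b) has_derivative
      (\<lambda>h. \<Sum>b\<in>Basis. (A' u h \<bullet> b) *\<^sub>R G z b)) (at z)"
  proof (intro has_derivative_sum has_derivative_scaleR_at_zero)
    show "((\<lambda>y. (A y u - v) \<bullet> b) has_derivative (\<lambda>h. A' u h \<bullet> b)) (at z)" for b
      using der by (auto intro!: derivative_eq_intros)
    show "(A z u - v) \<bullet> b = 0" for b using AG[OF \<open>z \<in> W\<close>] by (simp add: u_def)
    show "isCont (\<lambda>y. G y b) z" for b
      by (rule isCont_inverse_family[OF assms(1,2) lin(1) AG GA has_derivative_continuous[OF der]])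
  qed
  then have "((\<lambda>y. u - (\<Sum>b\<in>Basis. ((A y u - v) \<bullet> b) *\<^sub>R G y b)) has_derivative (\<lambda>h. - G z (A' u h))) (at z)"
    using has_derivative_diff[OF has_derivative_const[of u "at z"]] by (simp flip: ex[OF \<open>z \<in> W\<close>])
  then show ?thesis
    unfolding u_def[symmetric]
  proof (rule has_derivative_transform_within_open[OF _ assms(1,2)])
    fix y assume "y \<in> W"
    then have "(\<Sum>b\<in>Basis. ((A y u - v) \<bullet> b) *\<^sub>R G y b) = G y (A y u - v)" by (simp add: ex[of y "A y u - v"])
    also have "\<dots> = u - G y v" using lin(2) GA \<open>y \<in> W\<close> by (simp add: linear_diff)
    finally show "u - (\<Sum>b\<in>Basis. ((A y u - v) \<bullet> b) *\<^sub>R G y b) = G y v" by simp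
  qed
qed

text \<open>The classical theorem provides the local inverse \<open>g\<close> with derivative
\<open>g' y = inv (D (g y))\<close>. Smoothness of \<open>g\<close> is a bootstrap carried out for \<open>g\<close> and for all
\<open>y \<mapsto> g' y v\<close> together: by the rule for the derivative of an inverse,
the derivative of \<open>g' y v\<close> in direction \<open>h\<close> is
\<open>- g' y (D2 (g y) (g' y v) (g' y h))\<close>, which involves only \<open>g\<close>, \<open>g'\<close> and the second
derivative of the smooth map \<open>f\<close>. So each round gains one order of differentiability.\<close>
theorem smooth_inverse_function:
  fixes f :: "'a::euclidean_space \<Rightarrow> 'a"
  assumes "open U" and smooth: "smooth_on U f" and "x0 \<in> U"
    and inj: "inj (frechet_derivative f (at x0))"
  obtains V W g where "open V" "x0 \<in> V" "V \<subseteq> U" "open W" "homeomorphism V W f g" "smooth_on W g"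
proof -
  define D where "D x = frechet_derivative f (at x)" for x
  define D2 where "D2 x u = frechet_derivative (\<lambda>y. D y u) (at x)" for x u
  have D: "(f has_derivative D x) (at x)" if "x \<in> U" for x
    using smooth_on_has_derivative[OF smooth that] by (simp add: D_def)
  have D_smooth: "smooth_on U (\<lambda>x. D x u)" for u
    unfolding D_def by (rule smooth_on_frechet_derivative[OF smooth])
  have D2: "((\<lambda>y. D y u) has_derivative D2 x u) (at x)" if "x \<in> U" for x u
    using smooth_on_has_derivative[OF D_smooth that] by (simp add: D2_def)
  have D2_smooth: "smooth_on U (\<lambda>x. D2 x u w)" for u w
    unfolding D2_def by (rule smooth_on_frechet_derivative[OF D_smooth])
  have D_lin: "linear (D x)" if "x \<in> U" for x using has_derivative_linear[OF D[OF that]] .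
  have D2_lin: "linear (\<lambda>u. D2 x u w)" if "x \<in> U" for x w
  proof
    fix a b
    have "((\<lambda>y. D y (a + b)) has_derivative (\<lambda>w. D2 x a w + D2 x b w)) (at x)"
      by (rule has_derivative_transform_within_open[OF has_derivative_add[OF D2 D2] \<open>open U\<close>])
        (use that D_lin in \<open>auto simp: linear_add\<close>)
    from has_derivative_unique[OF D2[OF that] this] show "D2 x (a + b) w = D2 x a w + D2 x b w" by simp
  next
    fix c :: real and a
    have "((\<lambda>y. D y (c *\<^sub>R a)) has_derivative (\<lambda>w. c *\<^sub>R D2 x a w)) (at x)"
      by (rule has_derivative_transform_within_open[OF has_derivative_scaleR_right[OF D2] \<open>open U\<close>])
        (use that D_lin in \<open>auto simp: linear_cmul\<close>)
    from has_derivative_unique[OF D2[OF that] this] show "D2 x (c *\<^sub>R a) w = c *\<^sub>R D2 x a w" by simp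
  qed
  have Blin: "blinfun_apply (Blinfun (D x)) = D x" if "x \<in> U" for x
    using has_derivative_bounded_linear[OF D[OF that]] by (rule bounded_linear_Blinfun_apply)
  obtain L where L: "linear L" "L \<circ> D x0 = id"
    using linear_injective_left_inverse[OF D_lin[OF \<open>x0 \<in> U\<close>]] inj by (auto simp: D_def)
  obtain V W g g' where VW: "open V" "V \<subseteq> U" "x0 \<in> V" "open W" "f x0 \<in> W" "homeomorphism V W f g"
    and g': "\<And>y. y \<in> W \<Longrightarrow> (g has_derivative g' y) (at y)"
      "\<And>y. y \<in> W \<Longrightarrow> g' y = inv (blinfun_apply (Blinfun (D (g y))))"
      "\<And>y. y \<in> W \<Longrightarrow> bij (blinfun_apply (Blinfun (D (g y))))"
  proof (rule inverse_function_theorem[of U f "\<lambda>x. Blinfun (D x)" x0 "Blinfun L"])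
    show "(f has_derivative blinfun_apply (Blinfun (D x))) (at x)" if "x \<in> U" for x
      using D[OF that] by (simp add: Blin[OF that])
    show "continuous_on U (\<lambda>x. Blinfun (D x))"
    proof (rule continuous_on_blinfun_componentwise)
      show "continuous_on U (\<lambda>x. blinfun_apply (Blinfun (D x)) i)" for i
        using smooth_on_imp_continuous_on[OF D_smooth[of i]] by (simp add: Blin cong: continuous_on_cong)
    qed
    show "Blinfun L o\<^sub>L Blinfun (D x0) = id_blinfun"
      using L by (intro blinfun_eqI)
        (simp add: Blin[OF \<open>x0 \<in> U\<close>] bounded_linear_Blinfun_apply linear_conv_bounded_linear pointfree_idE)
  qed (use assms in auto)
  have gU: "g y \<in> U" if "y \<in> W" for y
    using VW that unfolding homeomorphism_def by auto
  have bij: "bij (D (g y))" and g'_inv: "g' y = inv (D (g y))" if "y \<in> W" for y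
    using g'(2,3)[OF that] by (simp_all add: Blin[OF gU[OF that]])
  have g'_der: "((\<lambda>y. g' y v) has_derivative (\<lambda>h. - g' y (D2 (g y) (g' y v) (g' y h)))) (at y)"
    if "y \<in> W" for y v
  proof (rule has_derivative_inverse_family[OF \<open>open W\<close> that, of "\<lambda>y. D (g y)" g' "\<lambda>u h. D2 (g y) u (g' y h)"])
    show "((\<lambda>y. D (g y) u) has_derivative (\<lambda>h. D2 (g y) u (g' y h))) (at y)" for u
      using has_derivative_compose[OF g'(1)[OF that] D2[OF gU[OF that]]] .
  qed (use bij g'_inv D_lin gU has_derivative_linear[OF g'(1)] in
      \<open>auto simp: bij_def surj_f_inv_f inv_f_f\<close>)
  have g'_lin: "linear (g' y)" if "y \<in> W" for y using has_derivative_linear[OF g'(1)[OF that]] .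
  have "times_differentiable_on n W g \<and> (\<forall>v. times_differentiable_on n W (\<lambda>y. g' y v))" for n
  proof (induction n)
    case 0
    then show ?case
      by (auto intro!: continuous_at_imp_continuous_on has_derivative_continuous[OF g'(1)]
          has_derivative_continuous[OF g'_der])
  next
    case (Suc n)
    have "times_differentiable_on n W (\<lambda>y. D2 (g y) u w)" for u w
      by (rule times_differentiable_on_compose[OF \<open>open W\<close> \<open>open U\<close>])
        (use Suc D2_smooth gU in \<open>auto simp: smooth_on_def\<close>)
    then have "times_differentiable_on n W (\<lambda>y. D2 (g y) u (g' y h))" for u h
      by (rule times_differentiable_on_apply_linear[OF \<open>open W\<close>, where L = "\<lambda>y. D2 (g y) u", rotated])
        (use Suc gU has_derivative_linear[OF D2] in auto)
    then have "times_differentiable_on n W (\<lambda>y. D2 (g y) (g' y v) (g' y h))" for v h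
      by (rule times_differentiable_on_apply_linear[OF \<open>open W\<close>, where L = "\<lambda>y u. D2 (g y) u (g' y h)", rotated])
        (use Suc gU D2_lin in auto)
    then have "times_differentiable_on n W (\<lambda>y. g' y (D2 (g y) (g' y v) (g' y h)))" for v h
      by (rule times_differentiable_on_apply_linear[OF \<open>open W\<close>, where L = g', rotated 2])
        (use Suc g'_lin in auto)
    then have "times_differentiable_on n W (\<lambda>y. - g' y (D2 (g y) (g' y v) (g' y h)))" for v h
      by (rule times_differentiable_on_linear_compose[OF \<open>open W\<close> bounded_linear_minus[OF bounded_linear_ident]])
    then show ?case
      using times_differentiable_on_SucI[OF \<open>open W\<close> g'(1)] times_differentiable_on_SucI[OF \<open>open W\<close> g'_der] Suc
      by blast
  qed
  then have "smooth_on W g" by (simp add: smooth_on_def)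
  with VW show ?thesis using that by blast
qed

section \<open>The Minkowski product and null frames\<close>

lemma bounded_bilinear_mink: "bounded_bilinear mink"
  unfolding bilinear_conv_bounded_bilinear[symmetric] bilinear_def
  by (auto intro!: linearI simp: mink_def algebra_simps)

interpretation mink: bounded_bilinear mink
  by (rule bounded_bilinear_mink)

lemma mink_commute: "mink u v = mink v u"
  by (simp add: mink_def mult.commute)

lemma mink_nondegenerate:
  assumes "\<And>v. mink u v = 0"
  shows "u = 0"
proof -
  have "u $ 1 = 0" "u $ 2 = 0" "u $ 3 = 0" "u $ 4 = 0"
    using assms[of "axis 1 1"] assms[of "axis 2 1"] assms[of "axis 3 1"] assms[of "axis 4 1"]
    by (auto simp: mink_def axis_def)
  then show ?thesis by (simp add: vec_eq_iff forall_4)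
qed

text \<open>Pseudo hyperspheres and pseudo hyperbolic hyperspheres are the cases \<open>c = r\<^sup>2\<close> and
\<open>c = - r\<^sup>2\<close>.\<close>
definition quadric :: "real \<Rightarrow> real^4 \<Rightarrow> (real^4) set" where
  "quadric c p = {u. mink (u - p) (u - p) = c}"

text \<open>The envelope condition sees the curve only through its unit tangent \<open>F1\<close>; the vectors
\<open>F2\<close>, \<open>F3\<close>, \<open>F4\<close> serve as a smooth moving basis of the normal space, with \<open>F2\<close> and
\<open>F4\<close> spanning a hyperbolic plane.\<close>
locale null_framed_curve =
  fixes I :: "real set" and \<gamma> F1 F2 F3 F4 :: "real \<Rightarrow> real^4"
  assumes open_I: "open I"
    and smooth: "smooth_on I \<gamma>" "smooth_on I F2" "smooth_on I F3" "smooth_on I F4"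
    and tangent: "\<And>s. s \<in> I \<Longrightarrow> (\<gamma> has_vector_derivative F1 s) (at s)"
    and gram: "\<And>s. s \<in> I \<Longrightarrow> mink (F1 s) (F1 s) = 1" "\<And>s. s \<in> I \<Longrightarrow> mink (F3 s) (F3 s) = 1"
      "\<And>s. s \<in> I \<Longrightarrow> mink (F2 s) (F4 s) = 1" "\<And>s. s \<in> I \<Longrightarrow> mink (F2 s) (F2 s) = 0"
      "\<And>s. s \<in> I \<Longrightarrow> mink (F4 s) (F4 s) = 0" "\<And>s. s \<in> I \<Longrightarrow> mink (F1 s) (F2 s) = 0"
      "\<And>s. s \<in> I \<Longrightarrow> mink (F1 s) (F3 s) = 0" "\<And>s. s \<in> I \<Longrightarrow> mink (F1 s) (F4 s) = 0"
      "\<And>s. s \<in> I \<Longrightarrow> mink (F2 s) (F3 s) = 0" "\<And>s. s \<in> I \<Longrightarrow> mink (F3 s) (F4 s) = 0"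
begin

lemma gram_commuted:
  assumes "s \<in> I"
  shows "mink (F4 s) (F2 s) = 1" "mink (F2 s) (F1 s) = 0" "mink (F3 s) (F1 s) = 0"
    "mink (F4 s) (F1 s) = 0" "mink (F3 s) (F2 s) = 0" "mink (F4 s) (F3 s) = 0"
  using gram[OF assms] by (simp_all add: mink_commute)

lemmas mink_expand = mink.add_left mink.add_right mink.scaleR_left mink.scaleR_right
  mink.diff_left mink.diff_right mink.minus_left mink.minus_right

text \<open>The Gram matrix is invertible, so the frame is a basis of \<open>\<real>\<^sup>4\<close>. Since \<open>F2\<close> and \<open>F4\<close>
are null and dual to each other, the coefficient of each of them is the product
with the other one.\<close>
lemma normal_expansion:
  assumes s: "s \<in> I" and "mink n (F1 s) = 0"
  shows "n = mink n (F4 s) *\<^sub>R F2 s + mink n (F3 s) *\<^sub>R F3 s + mink n (F2 s) *\<^sub>R F4 s"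
proof -
  define \<Phi> where "\<Phi> x = x$1 *\<^sub>R F1 s + x$2 *\<^sub>R F2 s + x$3 *\<^sub>R F3 s + x$4 *\<^sub>R F4 s" for x :: "real^4"
  note g = gram[OF s] gram_commuted[OF s] mink_expand
  have lin: "linear \<Phi>" by (rule linearI) (simp_all add: \<Phi>_def algebra_simps)
  have "x = 0" if "\<Phi> x = 0" for x
  proof -
    have "x$1 = mink (\<Phi> x) (F1 s)" "x$2 = mink (\<Phi> x) (F4 s)" "x$3 = mink (\<Phi> x) (F3 s)" "x$4 = mink (\<Phi> x) (F2 s)"
      by (simp_all add: \<Phi>_def g)
    then show ?thesis using that by (simp add: vec_eq_iff forall_4 mink.zero_left)
  qed
  then have "surj \<Phi>" using lin linear_injective_0 linear_injective_imp_surjective by blast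
  define m where "m = n - (mink n (F4 s) *\<^sub>R F2 s + mink n (F3 s) *\<^sub>R F3 s + mink n (F2 s) *\<^sub>R F4 s)"
  have "mink m (F1 s) = 0" "mink m (F2 s) = 0" "mink m (F3 s) = 0" "mink m (F4 s) = 0"
    using assms(2) by (simp_all add: m_def g)
  then have "mink m (\<Phi> x) = 0" for x by (simp add: \<Phi>_def mink_expand)
  then have "mink m v = 0" for v using \<open>surj \<Phi>\<close> by (metis surjD)
  then have "m = 0" by (rule mink_nondegenerate)
  then show ?thesis by (simp add: m_def)
qed

lemma mink_normal_self:
  assumes "s \<in> I" and "n = a2 *\<^sub>R F2 s + a3 *\<^sub>R F3 s + a4 *\<^sub>R F4 s"
  shows "mink n n = a3\<^sup>2 + 2 * (a2 * a4)" and "mink n (F1 s) = 0"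
  using gram[OF assms(1)] gram_commuted[OF assms(1)]
  by (simp_all add: assms(2) mink_expand power2_eq_square)

section \<open>The envelope condition\<close>
lemma curve_has_derivative:
  fixes x :: "real \<times> real \<times> real"
  assumes "fst x \<in> I"
  shows "((\<lambda>x. \<gamma> (fst x)) has_derivative (\<lambda>v. fst v *\<^sub>R F1 (fst x))) (at x)"
  using has_derivative_compose[OF has_derivative_fst[OF has_derivative_ident]]
    tangent[OF assms] unfolding has_vector_derivative_def by blast

text \<open>With \<open>N = T - \<gamma>\<close>, constancy of \<open>mink N N\<close> says that \<open>N\<close> is orthogonal to
\<open>DN v = DT v - fst v *\<^sub>R F1\<close>. So \<open>N\<close> is orthogonal to the hypersurface
exactly when it is orthogonal to the curve.\<close>
lemma mink_normal_derivative:
  fixes U :: "(real \<times> real \<times> real) set"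
  assumes "open U" "U \<subseteq> I \<times> UNIV" "smooth_on U T" "x \<in> U"
    and c: "\<And>y. y \<in> U \<Longrightarrow> mink (T y - \<gamma> (fst y)) (T y - \<gamma> (fst y)) = c"
  shows "mink (T x - \<gamma> (fst x)) (frechet_derivative T (at x) v) = fst v * mink (T x - \<gamma> (fst x)) (F1 (fst x))"
proof -
  let ?N = "\<lambda>y. T y - \<gamma> (fst y)"
  have s: "fst x \<in> I" using assms(2,4) by auto
  have N: "(?N has_derivative (\<lambda>v. frechet_derivative T (at x) v - fst v *\<^sub>R F1 (fst x))) (at x)"
    by (intro has_derivative_diff smooth_on_has_derivative[OF assms(3,4)] curve_has_derivative[OF s])
  have "((\<lambda>y. mink (?N y) (?N y)) has_derivative (\<lambda>v. 0)) (at x)"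
    by (rule has_derivative_transform_within_open[OF has_derivative_const[of c] assms(1,4)]) (simp add: c)
  from fun_cong[OF has_derivative_unique[OF this mink.FDERIV[OF N N]], of v]
  have "2 * mink (?N x) (frechet_derivative T (at x) v - fst v *\<^sub>R F1 (fst x)) = 0"
    by (simp add: mink_commute)
  then show ?thesis by (simp add: mink_expand)
qed

lemma tubular_envelope_iff:
  "tubular_envelope (quadric c) I \<gamma> U T \<longleftrightarrow>
     open U \<and> U \<subseteq> I \<times> UNIV \<and> smooth_on U T \<and>
     (\<forall>x\<in>U. mink (T x - \<gamma> (fst x)) (T x - \<gamma> (fst x)) = c \<and> mink (T x - \<gamma> (fst x)) (F1 (fst x)) = 0)"
  (is "_ \<longleftrightarrow> ?R")
proof
  assume env: "tubular_envelope (quadric c) I \<gamma> U T"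
  have "mink (T x - \<gamma> (fst x)) (F1 (fst x)) = 0" if "x \<in> U" for x
    using mink_normal_derivative[of U T x c "(1, 0, 0)"] env that
    unfolding tubular_envelope_def by (auto simp: quadric_def)
  then show ?R using env unfolding tubular_envelope_def by (auto simp: quadric_def)
next
  assume R: ?R
  then have "mink (T x - \<gamma> (fst x)) (frechet_derivative T (at x) v) = 0" if "x \<in> U" for x v
    using mink_normal_derivative[of U T x c v] that by auto
  then show "tubular_envelope (quadric c) I \<gamma> U T"
    using R unfolding tubular_envelope_def by (auto simp: quadric_def)
qed

lemma smooth_on_pullback:
  fixes U :: "(real \<times> real \<times> real) set"
  assumes "open U" "U \<subseteq> I \<times> UNIV" "smooth_on I F"
  shows "smooth_on U (\<lambda>x. F (fst x))"
  by (rule smooth_on_compose[OF assms(3) open_I assms(1) smooth_on_linear[OF assms(1) bounded_linear_fst]])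
    (use assms(2) in auto)

section \<open>The parametrized tubes\<close>

text \<open>The four parametrizations are one formula, with \<open>(S, C)\<close> a pair of circular or hyperbolic
functions satisfying \<open>C\<^sup>2 + \<kappa> S\<^sup>2 = \<sigma>\<close>: here \<open>\<kappa> = 1\<close> for the circular and \<open>\<kappa> = -1\<close>
for the hyperbolic pairs, and \<open>\<sigma> * r\<^sup>2\<close> is the constant of the quadric. The
function \<open>g\<close> distributes the product \<open>\<kappa> S\<^sup>2 / 2\<close> over the two null directions.\<close>
definition tube where
  "tube S C \<kappa> \<epsilon> r f g x = \<gamma> (fst x) - (\<epsilon> * r) *\<^sub>R
     ((g (snd x) * S (f (snd x))) *\<^sub>R F2 (fst x) + C (f (snd x)) *\<^sub>R F3 (fst x)
      + (\<kappa> * S (f (snd x)) / (2 * g (snd x))) *\<^sub>R F4 (fst x))"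
  for S C :: "real \<Rightarrow> real" and \<kappa> \<epsilon> r :: real and f g :: "real \<times> real \<Rightarrow> real"

lemma tubes_eq_tube:
  "tube1 \<epsilon> r \<gamma> F2 F3 F4 = tube sin cos 1 \<epsilon> r"
  "tube2 \<epsilon> r \<gamma> F2 F3 F4 = tube cos sin 1 \<epsilon> r"
  "tube3 \<epsilon> r \<gamma> F2 F3 F4 = tube sinh cosh (-1) \<epsilon> r"
  "tube4 \<epsilon> r \<gamma> F2 F3 F4 = tube cosh sinh (-1) \<epsilon> r"
  by (auto simp: fun_eq_iff tube1_def tube2_def tube3_def tube4_def tube_def)

lemma smooth_on_tube:
  assumes "smooth_on UNIV S" "smooth_on UNIV C" "admissible_pair D f g"
  shows "smooth_on (I \<times> D) (tube S C \<kappa> \<epsilon> r f g)"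
proof -
  have D: "open D" "smooth_on D f" "smooth_on D g" "\<And>z. z \<in> D \<Longrightarrow> g z \<noteq> 0"
    using assms(3) by (auto simp: admissible_pair_def)
  have op: "open (I \<times> D)" using open_I D(1) by (rule open_Times)
  have snd: "smooth_on (I \<times> D) (\<lambda>x. h (snd x))" if "smooth_on D h" for h :: "real \<times> real \<Rightarrow> real"
    by (rule smooth_on_compose[OF that D(1) op smooth_on_linear[OF op bounded_linear_snd]]) auto
  have comp: "smooth_on (I \<times> D) (\<lambda>x. h (f (snd x)))" if "smooth_on UNIV h" for h
    by (rule smooth_on_compose[OF that _ op snd[OF D(2)]]) auto
  have "smooth_on (I \<times> D) (\<lambda>x. \<gamma> (fst x) - (\<epsilon> * r) *\<^sub>R
     ((g (snd x) * S (f (snd x))) *\<^sub>R F2 (fst x) + C (f (snd x)) *\<^sub>R F3 (fst x)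
      + (\<kappa> * S (f (snd x)) / (2 * g (snd x))) *\<^sub>R F4 (fst x)))"
    by (intro smooth_on_diff smooth_on_add smooth_on_scaleR smooth_on_mult smooth_on_divide op
        smooth_on_const comp snd smooth_on_pullback smooth D assms) (use D in auto)
  then show ?thesis unfolding tube_def[abs_def] .
qed

lemma tubular_envelope_tube:
  assumes "smooth_on UNIV S" "smooth_on UNIV C" "admissible_pair D f g"
    and rel: "\<And>x. (C x)\<^sup>2 + \<kappa> * (S x)\<^sup>2 = \<sigma>" and "\<epsilon> \<in> {1, -1}"
  shows "tubular_envelope (quadric (\<sigma> * r\<^sup>2)) I \<gamma> (I \<times> D) (tube S C \<kappa> \<epsilon> r f g)"
  unfolding tubular_envelope_iff
proof (intro conjI ballI smooth_on_tube assms(1-3))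
  show "open (I \<times> D)" using open_I assms(3) by (auto simp: admissible_pair_def open_Times)
  fix x assume x: "x \<in> I \<times> D"
  then have s: "fst x \<in> I" by auto
  have g: "g (snd x) \<noteq> 0" using x assms(3) by (auto simp: admissible_pair_def)
  define \<phi> where "\<phi> = f (snd x)"
  have N: "tube S C \<kappa> \<epsilon> r f g x - \<gamma> (fst x) = (- \<epsilon> * r * (g (snd x) * S \<phi>)) *\<^sub>R F2 (fst x)
      + (- \<epsilon> * r * C \<phi>) *\<^sub>R F3 (fst x) + (- \<epsilon> * r * (\<kappa> * S \<phi> / (2 * g (snd x)))) *\<^sub>R F4 (fst x)"
    by (simp add: tube_def \<phi>_def algebra_simps)
  have "(- \<epsilon> * r * C \<phi>)\<^sup>2 + 2 * ((- \<epsilon> * r * (g (snd x) * S \<phi>)) * (- \<epsilon> * r * (\<kappa> * S \<phi> / (2 * g (snd x)))))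
      = r\<^sup>2 * ((C \<phi>)\<^sup>2 + \<kappa> * (S \<phi>)\<^sup>2)"
    using g \<open>\<epsilon> \<in> {1, -1}\<close> by (auto simp: field_simps power2_eq_square)
  with rel mink_normal_self[OF s N]
  show "mink (tube S C \<kappa> \<epsilon> r f g x - \<gamma> (fst x)) (tube S C \<kappa> \<epsilon> r f g x - \<gamma> (fst x)) = \<sigma> * r\<^sup>2"
    and "mink (tube S C \<kappa> \<epsilon> r f g x - \<gamma> (fst x)) (F1 (fst x)) = 0"
    by (simp_all add: mult.commute)
qed auto

section \<open>Coordinates on a tubular envelope\<close>
context
  fixes c :: real and U :: "(real \<times> real \<times> real) set" and T :: "real \<times> real \<times> real \<Rightarrow> real^4"
  assumes env: "tubular_envelope (quadric c) I \<gamma> U T" and reg: "regular_on U T"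
begin

text \<open>The index is dual: \<open>coord F4\<close> is the coefficient of \<open>F2\<close> in \<open>T - \<gamma>\<close> and \<open>coord F2\<close>
that of \<open>F4\<close>.\<close>
definition coord where "coord F x = mink (T x - \<gamma> (fst x)) (F (fst x))"

lemma domain: "open U" "U \<subseteq> I \<times> UNIV" "smooth_on U T"
  using env by (auto simp: tubular_envelope_iff)

lemma smooth_on_coord:
  assumes "smooth_on I F"
  shows "smooth_on U (coord F)"
  unfolding coord_def[abs_def]
  by (intro smooth_on_bilinear[OF bounded_bilinear_mink] smooth_on_diff smooth_on_pullback domain smooth assms)

lemma envelope_expansion:
  assumes "x \<in> U"
  shows "T x = \<gamma> (fst x) + (coord F4 x *\<^sub>R F2 (fst x) + coord F3 x *\<^sub>R F3 (fst x) + coord F2 x *\<^sub>R F4 (fst x))"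
    and "(coord F3 x)\<^sup>2 + 2 * (coord F4 x * coord F2 x) = c"
proof -
  have s: "fst x \<in> I" using assms domain by auto
  have "mink (T x - \<gamma> (fst x)) (T x - \<gamma> (fst x)) = c" "mink (T x - \<gamma> (fst x)) (F1 (fst x)) = 0"
    using env assms by (auto simp: tubular_envelope_iff)
  note exp = normal_expansion[OF s this(2), folded coord_def]
  show "T x = \<gamma> (fst x) + (coord F4 x *\<^sub>R F2 (fst x) + coord F3 x *\<^sub>R F3 (fst x) + coord F2 x *\<^sub>R F4 (fst x))"
    using exp by (metis add.commute diff_add_cancel)
  show "(coord F3 x)\<^sup>2 + 2 * (coord F4 x * coord F2 x) = c"
    using mink_normal_self(1)[OF s exp] \<open>mink (T x - \<gamma> (fst x)) (T x - \<gamma> (fst x)) = c\<close> by simp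
qed

text \<open>If one null coefficient vanished on an open set, the quadric would force the square of the
\<open>F3\<close>-coefficient \<open>b\<close>, hence \<open>b\<close> itself, to be locally constant there.
For fixed \<open>s\<close> the hypersurface would then move only along the line spanned by
\<open>E\<close>, which leaves no room for the two parameters \<open>t\<close> and \<open>w\<close> of a regular map.\<close>
lemma not_degenerate_on_open:
  assumes W: "open W" "W \<subseteq> U" "x \<in> W" and "smooth_on I E"
    and a: "smooth_on U a" and b: "smooth_on U b"
    and T: "\<And>y. y \<in> W \<Longrightarrow> T y = \<gamma> (fst y) + (a y *\<^sub>R E (fst y) + b y *\<^sub>R F3 (fst y))"
    and b2: "\<And>y. y \<in> W \<Longrightarrow> (b y)\<^sup>2 = k" and "k \<noteq> 0"
  shows False
proof -
  have x: "x \<in> U" "fst x \<in> I" using W domain by auto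
  define Da Db DT where "Da = frechet_derivative a (at x)" and "Db = frechet_derivative b (at x)"
    and "DT = frechet_derivative T (at x)"
  have der: "(a has_derivative Da) (at x)" "(b has_derivative Db) (at x)" "(T has_derivative DT) (at x)"
    using smooth_on_has_derivative a b domain(3) x(1) by (auto simp: Da_def Db_def DT_def)
  have frame_der: "((\<lambda>y. F (fst y)) has_derivative (\<lambda>v. frechet_derivative F (at (fst x)) (fst v))) (at x)"
    if "smooth_on I F" for F :: "real \<Rightarrow> real^4"
    by (rule has_derivative_compose[OF has_derivative_fst[OF has_derivative_ident]
          smooth_on_has_derivative[OF that x(2)]])
  have "((\<lambda>y. (b y)\<^sup>2) has_derivative (\<lambda>v. 0)) (at x)"
    by (rule has_derivative_transform_within_open[OF has_derivative_const[of k] W(1,3)]) (simp add: b2)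
  moreover have "((\<lambda>y. (b y)\<^sup>2) has_derivative (\<lambda>v. 2 * b x * Db v)) (at x)"
    using der(2) by (auto intro!: derivative_eq_intros)
  ultimately have "2 * b x * Db v = 0" for v using has_derivative_unique by metis
  moreover have "b x \<noteq> 0" using b2[OF W(3)] \<open>k \<noteq> 0\<close> by auto
  ultimately have Db: "Db v = 0" for v by simp
  have "(T has_derivative (\<lambda>v. fst v *\<^sub>R F1 (fst x)
      + ((a x *\<^sub>R frechet_derivative E (at (fst x)) (fst v) + Da v *\<^sub>R E (fst x))
      + (b x *\<^sub>R frechet_derivative F3 (at (fst x)) (fst v) + Db v *\<^sub>R F3 (fst x))))) (at x)"
    by (rule has_derivative_transform_within_open[OF _ W(1,3)])
      (auto intro!: has_derivative_add has_derivative_scaleR frame_der curve_has_derivative der smooth assms x simp: T)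
  moreover have zero: "frechet_derivative F (at (fst x)) 0 = 0" if "smooth_on I F" for F :: "real \<Rightarrow> real^4"
    using linear_0[OF has_derivative_linear[OF smooth_on_has_derivative[OF that x(2)]]] .
  ultimately have DT: "DT (0, z) = Da (0, z) *\<^sub>R E (fst x)" for z
    using has_derivative_unique[OF der(3)] by (simp add: Db zero[OF smooth(3)] zero[OF assms(4)])
  have inj: "inj DT" using reg x(1) by (auto simp: regular_on_def DT_def)
  have lin: "linear DT" "linear Da" using der has_derivative_linear by auto
  have kernel: "v = 0" if "DT v = 0" for v using that inj lin(1) linear_injective_0 by blast
  \<comment> \<open>The functional \<open>Da\<close> has a kernel on the plane of vectors \<open>(0, t, w)\<close>; this vector
    spans it unless \<open>Da\<close> vanishes on the whole plane.\<close>
  define p q where "p = Da (0, 1, 0)" and "q = Da (0, 0, 1)"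
  have "Da (0, q, - p) = Da (q *\<^sub>R (0, 1, 0) - p *\<^sub>R (0, 0, 1))" by simp
  also have "\<dots> = 0" using lin(2) by (simp only: linear_diff linear_cmul) (simp add: p_def q_def)
  finally have "DT (0, q, - p) = 0" by (simp add: DT)
  from kernel[OF this] have "p = 0" by (simp add: zero_prod_def)
  then have "DT (0, 1, 0) = 0" by (simp add: DT p_def)
  from kernel[OF this] show False by (simp add: zero_prod_def)
qed

lemma nondegenerate_dense:
  assumes "c \<noteq> 0"
  shows "U \<subseteq> closure {x \<in> U. coord F4 x * coord F2 x \<noteq> 0}"
proof (rule ccontr)
  define W where "W = U - closure {x \<in> U. coord F4 x * coord F2 x \<noteq> 0}"
  assume "\<not> U \<subseteq> closure {x \<in> U. coord F4 x * coord F2 x \<noteq> 0}"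
  then obtain x where x: "x \<in> W" by (auto simp: W_def)
  have W: "open W" "W \<subseteq> U" using domain(1) by (auto simp: W_def open_Diff)
  have prod: "coord F4 y * coord F2 y = 0" if "y \<in> W" for y
    using that closure_subset[of "{x \<in> U. coord F4 x * coord F2 x \<noteq> 0}"] by (auto simp: W_def)
  note coords = smooth_on_coord[OF smooth(2)] smooth_on_coord[OF smooth(3)] smooth_on_coord[OF smooth(4)]
  have b2: "(coord F3 y)\<^sup>2 = c" if "y \<in> W" for y
    using envelope_expansion(2)[of y] prod[OF that] W(2) that by auto
  show False
  proof (cases "\<exists>y\<in>W. coord F4 y \<noteq> 0")
    case True
    then obtain y where y: "y \<in> W" "coord F4 y \<noteq> 0" by blast
    let ?W = "W \<inter> coord F4 -` (- {0})"
    have "continuous_on W (coord F4)"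
      using smooth_on_imp_continuous_on[OF coords(3)] W(2) continuous_on_subset by blast
    then have "open ?W" using W(1) by (rule continuous_open_preimage) auto
    moreover have "T z = \<gamma> (fst z) + (coord F4 z *\<^sub>R F2 (fst z) + coord F3 z *\<^sub>R F3 (fst z))"
      if "z \<in> ?W" for z
      using envelope_expansion(1)[of z] prod[of z] that W(2) by auto
    ultimately show False
      using not_degenerate_on_open[of ?W y F2 "coord F4" "coord F3" c] y W(2) b2 assms coords smooth by auto
  next
    case False
    then have "T z = \<gamma> (fst z) + (coord F2 z *\<^sub>R F4 (fst z) + coord F3 z *\<^sub>R F3 (fst z))" if "z \<in> W" for z
      using envelope_expansion(1)[of z] that W(2) by auto
    then show False
      using not_degenerate_on_open[of W x F4 "coord F2" "coord F3" c] x W b2 assms coords smooth by auto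
  qed
qed

section \<open>Local reparametrization as a tube\<close>

text \<open>Comparing coefficients determines the new parameters: \<open>coord F3 = - \<epsilon> r C f\<close> is solved
for \<open>f\<close> with a smooth right inverse \<open>A\<close> of \<open>C\<close>, and then \<open>coord F4 = - \<epsilon> r g S f\<close> is
solved for \<open>g\<close>. The remaining coefficient agrees automatically because \<open>T\<close> lies on the
quadric. Using the values of \<open>f\<close> and \<open>g\<close> themselves as parameters, that is, the
parametrization with \<open>fst\<close> and \<open>snd\<close> as its two functions, gives
\<open>T = tube \<circ> h\<close> with \<open>h (s, t, w) = (s, f, g)\<close>. Regularity of \<open>T\<close> forces \<open>Dh\<close> to be
injective, so \<open>h\<close> is a local diffeomorphism.\<close>
lemma parametrizable_near_tube:
  assumes S: "smooth_on UNIV S" and C: "smooth_on UNIV C"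
    and rel: "\<And>x. (C x)\<^sup>2 + \<kappa> * (S x)\<^sup>2 = \<sigma>" and "\<kappa> \<noteq> 0"
    and "open B" and A: "smooth_on B A" and CA: "\<And>u. u \<in> B \<Longrightarrow> C (A u) = u"
    and SA: "\<And>u. u \<in> B \<Longrightarrow> S (A u) \<noteq> 0"
    and \<epsilon>: "\<epsilon> \<in> {1, -1}" and "r > 0" and c: "c = \<sigma> * r\<^sup>2"
    and "x \<in> U" and xB: "- \<epsilon> * coord F3 x / r \<in> B"
  shows "parametrizable_near (tube S C \<kappa> \<epsilon> r) U T x"
proof -
  define u where "u y = - \<epsilon> / r * coord F3 y" for y
  define h where "h y = (fst y, A (u y), - \<epsilon> / r * coord F4 y / S (A (u y)))" for y
  define W where "W = U \<inter> u -` B"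
  have smooth_u: "smooth_on U u"
    unfolding u_def[abs_def]
    by (intro smooth_on_mult smooth_on_const smooth_on_coord smooth domain)
  have W: "open W" "W \<subseteq> U" "x \<in> W" "\<And>y. y \<in> W \<Longrightarrow> u y \<in> B"
    using continuous_open_preimage[OF smooth_on_imp_continuous_on[OF smooth_u] domain(1) \<open>open B\<close>]
      xB \<open>x \<in> U\<close> by (auto simp: W_def u_def)
  have WI: "fst y \<in> I" if "y \<in> W" for y using that W(2) domain(2) by auto
  have smooth_Au: "smooth_on W (\<lambda>y. A (u y))"
    by (rule smooth_on_compose[OF A \<open>open B\<close> W(1) smooth_on_subset[OF smooth_u W(2)] W(4)])
  have "smooth_on W (\<lambda>y. S (A (u y)))"
    by (rule smooth_on_compose[OF S open_UNIV W(1) smooth_Au]) simp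
  then have quot: "smooth_on W (\<lambda>y. - \<epsilon> / r * coord F4 y / S (A (u y)))"
    by (intro smooth_on_divide smooth_on_mult smooth_on_const W(1)
        smooth_on_subset[OF smooth_on_coord[OF smooth(4)] W(2)] SA W(4)) auto
  have smooth_h: "smooth_on W h"
    unfolding h_def[abs_def]
    by (intro smooth_on_Pair smooth_Au quot smooth_on_linear[OF _ bounded_linear_fst] W(1))
  have coords: "coord F3 y = - \<epsilon> * r * u y"
    "2 * (coord F4 y * coord F2 y) = r\<^sup>2 * (\<kappa> * (S (A (u y)))\<^sup>2)" if "y \<in> W" for y
  proof -
    show 1: "coord F3 y = - \<epsilon> * r * u y" using \<epsilon> \<open>r > 0\<close> by (auto simp: u_def)
    have "(coord F3 y)\<^sup>2 + 2 * (coord F4 y * coord F2 y) = \<sigma> * r\<^sup>2"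
      using envelope_expansion(2)[of y] that W(2) c by auto
    moreover have "(coord F3 y)\<^sup>2 = r\<^sup>2 * (u y)\<^sup>2" using 1 \<epsilon> by (auto simp: power_mult_distrib)
    moreover have "\<sigma> = (u y)\<^sup>2 + \<kappa> * (S (A (u y)))\<^sup>2" using rel[of "A (u y)"] CA[OF W(4)[OF that]] by simp
    ultimately show "2 * (coord F4 y * coord F2 y) = r\<^sup>2 * (\<kappa> * (S (A (u y)))\<^sup>2)"
      by (simp add: algebra_simps)
  qed
  have F4_nz: "coord F4 y \<noteq> 0" if "y \<in> W" for y
    using coords(2)[OF that] \<open>\<kappa> \<noteq> 0\<close> \<open>r > 0\<close> SA[OF W(4)[OF that]] by auto
  have h_nz: "snd (snd (h y)) \<noteq> 0" if "y \<in> W" for y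
    using F4_nz[OF that] \<epsilon> \<open>r > 0\<close> SA[OF W(4)[OF that]] by (auto simp: h_def)
  have T_eq: "T y = tube S C \<kappa> \<epsilon> r fst snd (h y)" if "y \<in> W" for y
  proof -
    let ?s = "S (A (u y))" and ?g = "snd (snd (h y))"
    have s: "?s \<noteq> 0" using SA[OF W(4)[OF that]] .
    have 2: "- (\<epsilon> * r) * (?g * ?s) = coord F4 y" using s \<epsilon> \<open>r > 0\<close> by (auto simp: h_def)
    have 3: "- (\<epsilon> * r) * C (A (u y)) = coord F3 y" using CA[OF W(4)[OF that]] coords(1)[OF that] by simp
    have "- (\<epsilon> * r) * (\<kappa> * ?s / (2 * ?g)) = r\<^sup>2 * (\<kappa> * ?s\<^sup>2) / (2 * coord F4 y)"
      using s \<epsilon> \<open>r > 0\<close> F4_nz[OF that] by (auto simp: h_def field_simps power2_eq_square)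
    also have "\<dots> = coord F2 y" using coords(2)[OF that] F4_nz[OF that] by (simp add: field_simps)
    finally have 4: "- (\<epsilon> * r) * (\<kappa> * ?s / (2 * ?g)) = coord F2 y" .
    have "tube S C \<kappa> \<epsilon> r fst snd (h y) = \<gamma> (fst y) + ((- (\<epsilon> * r) * (?g * ?s)) *\<^sub>R F2 (fst y)
        + (- (\<epsilon> * r) * C (A (u y))) *\<^sub>R F3 (fst y) + (- (\<epsilon> * r) * (\<kappa> * ?s / (2 * ?g))) *\<^sub>R F4 (fst y))"
      by (simp add: tube_def h_def algebra_simps)
    also have "\<dots> = T y" unfolding 2 3 4 using envelope_expansion(1)[of y] that W(2) by auto
    finally show ?thesis by simp
  qed
  have adm: "admissible_pair D fst snd" if "open D" "\<And>z. z \<in> D \<Longrightarrow> snd z \<noteq> 0" for D :: "(real \<times> real) set"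
    using that by (auto simp: admissible_pair_def intro: smooth_on_linear bounded_linear_fst bounded_linear_snd)
  have "inj (frechet_derivative h (at x))"
  proof -
    let ?D = "UNIV \<times> - {0} :: (real \<times> real) set" and ?Y = "tube S C \<kappa> \<epsilon> r fst snd"
    have "smooth_on (I \<times> ?D) ?Y" by (intro smooth_on_tube adm S C open_Times) auto
    moreover have "h x \<in> I \<times> ?D" using h_nz[OF W(3)] WI[OF W(3)] by (cases "h x") (auto simp: h_def)
    ultimately have Y: "(?Y has_derivative frechet_derivative ?Y (at (h x))) (at (h x))"
      by (rule smooth_on_has_derivative)
    have h: "(h has_derivative frechet_derivative h (at x)) (at x)"
      by (rule smooth_on_has_derivative[OF smooth_h W(3)])
    have "(T has_derivative (\<lambda>v. frechet_derivative ?Y (at (h x)) (frechet_derivative h (at x) v))) (at x)"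
      by (rule has_derivative_transform_within_open[OF has_derivative_compose[OF h Y] W(1,3)])
        (simp add: T_eq)
    then have DT: "frechet_derivative T (at x)
        = (\<lambda>v. frechet_derivative ?Y (at (h x)) (frechet_derivative h (at x) v))"
      by (rule frechet_derivative_at[symmetric])
    have "inj (frechet_derivative T (at x))" using reg \<open>x \<in> U\<close> by (auto simp: regular_on_def)
    then show ?thesis unfolding DT inj_def by metis
  qed
  from smooth_inverse_function[OF W(1) smooth_h W(3) this]
  obtain V0 W0 k where V0: "open V0" "x \<in> V0" "V0 \<subseteq> W" "open W0" "homeomorphism V0 W0 h k" "smooth_on W0 k"
    by blast
  have "h x \<in> W0" using V0(2,5) by (auto simp: homeomorphism_def)
  \<comment> \<open>The image of the change of parameters has to be a box over an interval, so it is shrunk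
    to one.\<close>
  then obtain J0 D where JD: "open J0" "open D" "h x \<in> J0 \<times> D" "J0 \<times> D \<subseteq> W0"
    using open_prod_elim[OF V0(4)] by metis
  have hx: "fst x \<in> J0" "snd (h x) \<in> D" using JD(3) by (auto simp: h_def)
  obtain e where e: "e > 0" "ball (fst x) e \<subseteq> J0" using JD(1) hx(1) open_contains_ball by blast
  define J where "J = ball (fst x) e"
  define V where "V = V0 \<inter> h -` (J \<times> D)"
  have J: "open J" "is_interval J" "fst x \<in> J" "J \<subseteq> J0"
    using e by (auto simp: J_def is_interval_ball_real)
  have smooth_hV: "smooth_on V0 h" using smooth_on_subset[OF smooth_h V0(3)] .
  have "open V"
    unfolding V_def using J JD V0(1) smooth_on_imp_continuous_on[OF smooth_hV]
    by (intro continuous_open_preimage open_Times) auto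
  have sub: "J \<times> D \<subseteq> W0" using JD(4) J(4) by auto
  have "h ` V0 = W0" using V0(5) by (auto simp: homeomorphism_def)
  moreover have "h ` (V0 \<inter> h -` B) = h ` V0 \<inter> B" for B by blast
  ultimately have im: "h ` V = J \<times> D" using sub unfolding V_def by blast
  have "V \<subseteq> V0" by (simp add: V_def)
  then have hom: "homeomorphism V (J \<times> D) h k"
    by (rule homeomorphism_of_subsets[OF V0(5) _ sub im])
  have "snd z \<noteq> 0" if "z \<in> D" for z
  proof -
    have "(fst x, z) \<in> h ` V" using that J(3) im by auto
    then obtain y where "y \<in> V" "h y = (fst x, z)" by (metis imageE)
    then show ?thesis using h_nz[of y] V0(3) by (auto simp: V_def)
  qed
  then have "admissible_pair D fst snd" using JD(2) adm by blast
  moreover have "diffeomorphism_between V (J \<times> D) h"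
    unfolding diffeomorphism_between_def
    using hom smooth_on_subset[OF smooth_hV, of V] smooth_on_subset[OF V0(6) sub] by (auto simp: V_def)
  moreover have "x \<in> V" using V0(2) J(3) hx(2) by (cases "h x") (auto simp: V_def h_def)
  moreover have "V \<subseteq> W" "V \<subseteq> U" using V0(3) W(2) by (auto simp: V_def)
  ultimately show ?thesis
    unfolding parametrizable_near_def using \<open>open V\<close> J T_eq
    by (intro exI[of _ V] exI[of _ J] exI[of _ D] exI[of _ fst] exI[of _ snd] exI[of _ h]) (auto simp: h_def)
qed

end

end

section \<open>Tubular hypersurfaces of a pseudo null curve\<close>
lemma null_framed_curve_of_frenet:
  assumes "pseudo_null_curve I \<gamma>" "pseudo_null_frenet_frame I \<gamma> F1 F2 F3 F4 k1 k2 k3"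
  shows "null_framed_curve I \<gamma> F1 F2 F3 F4"
  using assms unfolding pseudo_null_curve_def pseudo_null_frenet_frame_def
  by unfold_locales auto

theorem theorem6:
  fixes I :: "real set" and \<gamma> F1 F2 F3 F4 :: "real \<Rightarrow> real^4"
    and k1 :: real and k2 k3 :: "real \<Rightarrow> real" and r :: real
  assumes curve: "pseudo_null_curve I \<gamma>"
    and frame: "pseudo_null_frenet_frame I \<gamma> F1 F2 F3 F4 k1 k2 k3"
    and r: "r > 0"
  shows
    "(\<forall>D f g. \<forall>\<epsilon>\<in>{1, -1}. admissible_pair D f g \<longrightarrow>
        tubular_envelope (pseudo_hypersphere r) I \<gamma> (I \<times> D) (tube1 \<epsilon> r \<gamma> F2 F3 F4 f g) \<and>
        tubular_envelope (pseudo_hypersphere r) I \<gamma> (I \<times> D) (tube2 \<epsilon> r \<gamma> F2 F3 F4 f g) \<and>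
        tubular_envelope (pseudo_hypersphere r) I \<gamma> (I \<times> D) (tube3 \<epsilon> r \<gamma> F2 F3 F4 f g) \<and>
        tubular_envelope (pseudo_hyperbolic_hypersphere r) I \<gamma> (I \<times> D)
          (tube4 \<epsilon> r \<gamma> F2 F3 F4 f g)) \<and>
     (\<forall>U T. tubular_envelope (pseudo_hypersphere r) I \<gamma> U T \<and> regular_on U T \<longrightarrow>
        U \<subseteq> closure {x \<in> U. null_coord_product \<gamma> F2 F4 T x \<noteq> 0} \<and>
        (\<forall>x\<in>U.
          (null_coord_product \<gamma> F2 F4 T x > 0 \<longrightarrow>
             (\<forall>\<epsilon>\<in>{1, -1}. parametrizable_near (tube1 \<epsilon> r \<gamma> F2 F3 F4) U T x \<and>
                            parametrizable_near (tube2 \<epsilon> r \<gamma> F2 F3 F4) U T x)) \<and>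
          (null_coord_product \<gamma> F2 F4 T x < 0 \<longrightarrow>
             (\<exists>\<epsilon>\<in>{1, -1}. parametrizable_near (tube3 \<epsilon> r \<gamma> F2 F3 F4) U T x)))) \<and>
     (\<forall>U T. tubular_envelope (pseudo_hyperbolic_hypersphere r) I \<gamma> U T \<and> regular_on U T \<longrightarrow>
        (\<forall>x\<in>U. \<forall>\<epsilon>\<in>{1, -1}. parametrizable_near (tube4 \<epsilon> r \<gamma> F2 F3 F4) U T x))"
proof -
  interpret null_framed_curve I \<gamma> F1 F2 F3 F4
    using null_framed_curve_of_frenet[OF curve frame] .
  have quadrics: "pseudo_hypersphere r = quadric (1 * r\<^sup>2)"
      "pseudo_hyperbolic_hypersphere r = quadric (- 1 * r\<^sup>2)"
    by (auto simp: fun_eq_iff pseudo_hypersphere_def pseudo_hyperbolic_hypersphere_def quadric_def)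
  have circ: "(cos x)\<^sup>2 + 1 * (sin x)\<^sup>2 = 1" "(sin x)\<^sup>2 + 1 * (cos x)\<^sup>2 = 1" for x :: real
    by simp_all
  have hyp: "(cosh x)\<^sup>2 + - 1 * (sinh x)\<^sup>2 = 1" "(sinh x)\<^sup>2 + - 1 * (cosh x)\<^sup>2 = - 1" for x :: real
    using hyperbolic_pythagoras[of x] by simp_all
  note trig = smooth_on_sin_cos smooth_on_sinh_cosh
  have cos_arcsin_nz: "cos (arcsin u) \<noteq> 0" and sin_arccos_nz: "sin (arccos u) \<noteq> 0"
    if "u \<in> {-1<..<1}" for u
    using that cos_arcsin_nonzero sin_arccos_nonzero by auto
  have sinh_arcosh_nz: "sinh (arcosh u) \<noteq> 0" if "u \<in> {1<..}" for u :: real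
    using that cosh_arcosh_real[of u] by auto
  show ?thesis
    unfolding tubes_eq_tube quadrics
  proof (intro conjI allI ballI impI; (elim conjE)?)
    fix D f g \<epsilon> assume "\<epsilon> \<in> {1, - 1 :: real}" and "admissible_pair D f g"
    note tube = tubular_envelope_tube[OF _ _ this(2) _ this(1)]
    show "tubular_envelope (quadric (1 * r\<^sup>2)) I \<gamma> (I \<times> D) (tube sin cos 1 \<epsilon> r f g)"
      by (rule tube[OF trig(1,2) circ(1)])
    show "tubular_envelope (quadric (1 * r\<^sup>2)) I \<gamma> (I \<times> D) (tube cos sin 1 \<epsilon> r f g)"
      by (rule tube[OF trig(2,1) circ(2)])
    show "tubular_envelope (quadric (1 * r\<^sup>2)) I \<gamma> (I \<times> D) (tube sinh cosh (- 1) \<epsilon> r f g)"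
      by (rule tube[OF trig(3,4) hyp(1)])
    show "tubular_envelope (quadric (- 1 * r\<^sup>2)) I \<gamma> (I \<times> D) (tube cosh sinh (- 1) \<epsilon> r f g)"
      by (rule tube[OF trig(4,3) hyp(2)])
  next
    fix U T
    assume env: "tubular_envelope (quadric (1 * r\<^sup>2)) I \<gamma> U T" and reg: "regular_on U T"
    \<comment> \<open>On a pseudo hypersphere the sign of the product decides whether \<open>\<bar>coord T F3 x\<bar>\<close> is below
      or above \<open>r\<close>, hence whether a cosine or a hyperbolic cosine can take the value.\<close>
    have prod: "null_coord_product \<gamma> F2 F4 T x = coord T F4 x * coord T F2 x" for x
      by (simp add: null_coord_product_def coord_def[OF env reg])
    show "U \<subseteq> closure {x \<in> U. null_coord_product \<gamma> F2 F4 T x \<noteq> 0}"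
      unfolding prod using nondegenerate_dense[OF env reg] r by simp
    fix x assume x: "x \<in> U"
    have eq: "(coord T F3 x)\<^sup>2 = r\<^sup>2 - 2 * null_coord_product \<gamma> F2 F4 T x"
      using envelope_expansion(2)[OF env reg x] by (simp add: prod)
    {
      assume "null_coord_product \<gamma> F2 F4 T x > 0"
      then have "\<bar>coord T F3 x\<bar>\<^sup>2 < r\<^sup>2" using eq by simp
      then have "\<bar>coord T F3 x\<bar> < r" by (rule power_less_imp_less_base) (use r in simp)
      then have B: "- \<epsilon> * coord T F3 x / r \<in> {-1<..<1}" if "\<epsilon> \<in> {1, - 1}" for \<epsilon>
        using that r by (auto simp: field_simps abs_less_iff)
      fix \<epsilon> :: real assume \<epsilon>: "\<epsilon> \<in> {1, - 1}"
      show "parametrizable_near (tube sin cos 1 \<epsilon> r) U T x"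
        by (rule parametrizable_near_tube[OF env reg trig(1,2) circ(1) _ _ smooth_on_arccos
              _ sin_arccos_nz \<epsilon> r _ x B[OF \<epsilon>]]) auto
      show "parametrizable_near (tube cos sin 1 \<epsilon> r) U T x"
        by (rule parametrizable_near_tube[OF env reg trig(2,1) circ(2) _ _ smooth_on_arcsin
              _ cos_arcsin_nz \<epsilon> r _ x B[OF \<epsilon>]]) auto
    }
    assume "null_coord_product \<gamma> F2 F4 T x < 0"
    then have "r\<^sup>2 < \<bar>coord T F3 x\<bar>\<^sup>2" using eq by simp
    then have "r < \<bar>coord T F3 x\<bar>" by (rule power_less_imp_less_base) simp
    \<comment> \<open>A hyperbolic cosine is positive, so \<open>\<epsilon>\<close> has to be opposite to the sign of \<open>coord T F3 x\<close>.\<close>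
    then obtain \<epsilon> :: real where \<epsilon>: "\<epsilon> \<in> {1, - 1}" and B: "- \<epsilon> * coord T F3 x / r \<in> {1<..}"
      using r by (cases "coord T F3 x > 0") (force simp: field_simps)+
    have "parametrizable_near (tube sinh cosh (- 1) \<epsilon> r) U T x"
      by (rule parametrizable_near_tube[OF env reg trig(3,4) hyp(1) _ _ smooth_on_arcosh
            _ sinh_arcosh_nz \<epsilon> r _ x B]) auto
    then show "\<exists>\<epsilon>\<in>{1, - 1}. parametrizable_near (tube sinh cosh (- 1) \<epsilon> r) U T x"
      using \<epsilon> by blast
  next
    fix U T x \<epsilon>
    assume env: "tubular_envelope (quadric (- 1 * r\<^sup>2)) I \<gamma> U T" and reg: "regular_on U T"
      and x: "x \<in> U" and \<epsilon>: "\<epsilon> \<in> {1, - 1 :: real}"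
    show "parametrizable_near (tube cosh sinh (- 1) \<epsilon> r) U T x"
      by (rule parametrizable_near_tube[OF env reg trig(4,3) hyp(2) _ _ smooth_on_arsinh
            _ _ \<epsilon> r _ x UNIV_I]) auto
  qed
qed

end
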